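(* Let $q=p^r>9$ be a power of a prime $p\neq 2$ such that $r=1$ or $q\equiv 3\pmod 4$. Let $\mathcal{P}\subseteq\mathbb{F}_q'$ be an integral point set of cardinality $q$. Then $\mathcal{P}$ is isomorphic to one of the following sets: (a) the line $1\cdot\mathbb{F}_q=\{t\mid t\in\mathbb{F}_q\}$; (b) (only if $q\equiv 1\pmod 4$) the line $(1+\omega_q i)\cdot\mathbb{F}_q=\{(1+\omega_q i)t\mid t\in\mathbb{F}_q\}$; (c) (only if $q\equiv 1\pmod 4$) the set $(1\pm\omega_q i)\square_q=\{(1+\omega_q i)s\mid s\in\square_q\}\cup\{(1-\omega_q i)s\mid s\in\square_q\}$.
   Context: $\mathbb{F}_q'=\mathbb{F}_q[x]/(x^2+1)$, with $i$ the class of $x$; its elements are written uniquely $a+bi$ with $a,b\in\mathbb{F}_q$, and it is identified with $\mathbb{F}_q^2$ via $(a,b)\mapsto a+bi$. $\square_q=\{t^2\mid t\in\mathbb{F}_q\}$ (including $0$). For $q\equiv 1\pmod 4$, $\omega_q\in\mathbb{F}_q$ denotes a fixed element with $\omega_q^2=-1$. The squared distance is $d^2(a+bi,c+di)=(a-c)^2+(b-d)^2$. Two points are at integral distance if their squared distance lies in $\square_q$; $\Delta(u,v)=1$ if $u,v$ are at integral distance and $0$ otherwise. An integral point set is a set of points which are pairwise at integral distance. An automorphism of $\mathbb{F}_q'$ with respect to $\Delta$ is a bijection $\varphi$ of $\mathbb{F}_q'$ with $\Delta(\varphi(u),\varphi(v))=\Delta(u,v)$ for all $u,v$ and such that for all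 $u,w\in\mathbb{F}_q'$ there are $u',w'\in\mathbb{F}_q'$ with $\{\varphi(u+tw)\mid t\in\mathbb{F}_q\}=\{u'+tw'\mid t\in\mathbb{F}_q\}$. Two point sets are isomorphic if some such automorphism maps one onto the other. *)

theory Defs
  imports "HOL-Computational_Algebra.Polynomial"
begin

text \<open>The ring \<open>F[x]/(x\<^sup>2+1)\<close> over a field \<open>F\<close>. For finite \<open>F\<close> with \<open>q\<close> elements
  it is a field exactly when \<open>q \<equiv> 3 (mod 4)\<close>, hence only a ring instance is given.\<close>

abbreviation gauss_modulus :: "'a::field poly" where
  "gauss_modulus \<equiv> [:1, 0, 1:]"

definition gauss_rel :: "'a::field poly \<Rightarrow> 'a poly \<Rightarrow> bool" where
  "gauss_rel f g \<longleftrightarrow> gauss_modulus dvd (f - g)"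

lemma gauss_rel_iff_mod: "gauss_rel f g \<longleftrightarrow> f mod gauss_modulus = g mod gauss_modulus"
  unfolding gauss_rel_def by (rule mod_eq_dvd_iff [symmetric])

quotient_type (overloaded) 'a gauss = "'a::field poly" / gauss_rel
  by (auto intro!: equivpI reflpI sympI transpI simp: gauss_rel_iff_mod)

instantiation gauss :: (field) comm_ring_1
begin

lift_definition zero_gauss :: "'a gauss" is 0 .
lift_definition one_gauss :: "'a gauss" is 1 .
lift_definition plus_gauss :: "'a gauss \<Rightarrow> 'a gauss \<Rightarrow> 'a gauss" is "(+)"
  unfolding gauss_rel_iff_mod by (rule mod_add_cong)
lift_definition uminus_gauss :: "'a gauss \<Rightarrow> 'a gauss" is uminus
  unfolding gauss_rel_iff_mod by (rule mod_minus_cong)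
lift_definition minus_gauss :: "'a gauss \<Rightarrow> 'a gauss \<Rightarrow> 'a gauss" is "(-)"
  unfolding gauss_rel_iff_mod by (rule mod_diff_cong)
lift_definition times_gauss :: "'a gauss \<Rightarrow> 'a gauss \<Rightarrow> 'a gauss" is "(*)"
  unfolding gauss_rel_iff_mod by (rule mod_mult_cong)

instance
proof
  show "(0::'a gauss) \<noteq> 1"
    by transfer (auto simp: gauss_rel_def dest: dvd_imp_degree_le)
qed (transfer; simp add: gauss_rel_def algebra_simps)+

end

lift_definition gauss_of :: "'a::field \<Rightarrow> 'a gauss" is "\<lambda>a. [:a:]" .
lift_definition gauss_i :: "'a::field gauss" is "[:0, 1:]" .

text \<open>The coordinates \<open>a\<close> and \<open>b\<close> of \<open>a + bi\<close> are read off the representative of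
  degree less than 2.\<close>

lift_definition gauss_re :: "'a::field gauss \<Rightarrow> 'a" is "\<lambda>f. coeff (f mod gauss_modulus) 0"
  by (simp add: gauss_rel_iff_mod)
lift_definition gauss_im :: "'a::field gauss \<Rightarrow> 'a" is "\<lambda>f. coeff (f mod gauss_modulus) 1"
  by (simp add: gauss_rel_iff_mod)

lemma gauss_i_squared: "gauss_i ^ 2 = (-1 :: 'a::field gauss)"
  unfolding power2_eq_square by transfer (simp add: gauss_rel_def one_pCons)

lemma gauss_re_Gauss [simp]: "gauss_re (gauss_of a + gauss_of b * gauss_i) = a"
  by transfer (simp add: mod_poly_less)

lemma gauss_im_Gauss [simp]: "gauss_im (gauss_of a + gauss_of b * gauss_i) = b"
  by transfer (simp add: mod_poly_less)

lemma poly_eq_if_degree_less_2: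
  assumes "degree f < 2"
  shows "f = [:coeff f 0, coeff f 1:]"
proof (rule poly_eqI)
  fix n
  show "coeff f n = coeff [:coeff f 0, coeff f 1:] n"
    using assms by (cases n; cases "n - 1") (auto simp: coeff_pCons coeff_eq_0 split: nat.splits)
qed

lemma gauss_eq: "z = gauss_of (gauss_re z) + gauss_of (gauss_im z) * gauss_i"
proof (transfer, unfold gauss_rel_iff_mod)
  fix f :: "'a poly"
  let ?m = "gauss_modulus :: 'a poly"
  have "degree (f mod ?m) < 2"
    using degree_mod_less[of ?m f] by auto
  from poly_eq_if_degree_less_2[OF this]
  show "f mod ?m = ([:coeff (f mod ?m) 0:] + [:coeff (f mod ?m) 1:] * [:0, 1:]) mod ?m"
    by simp
qed

lemma gauss_unique_repr:
  "\<exists>!(a, b). z = gauss_of a + gauss_of b * gauss_i"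
  by (rule ex1I[of _ "(gauss_re z, gauss_im z)"]) (use gauss_eq[of z] in auto)

definition squares :: "'a::field set" where
  "squares = {t ^ 2 | t. True}"

definition sqdist :: "'a::field gauss \<Rightarrow> 'a gauss \<Rightarrow> 'a" where
  "sqdist u v = (gauss_re u - gauss_re v) ^ 2 + (gauss_im u - gauss_im v) ^ 2"

definition int_dist :: "'a::field gauss \<Rightarrow> 'a gauss \<Rightarrow> nat" where
  "int_dist u v = (if sqdist u v \<in> squares then 1 else 0)"

definition integral_point_set :: "'a::field gauss set \<Rightarrow> bool" where
  "integral_point_set P \<longleftrightarrow> (\<forall>u\<in>P. \<forall>v\<in>P. int_dist u v = 1)"

text \<open>The direction \<open>w\<close> of a line may be zero, so that ``lines'' include single points.\<close>

definition gauss_line :: "'a::field gauss \<Rightarrow> 'a gauss \<Rightarrow> 'a gauss set" where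
  "gauss_line u w = {u + gauss_of t * w | t. True}"

definition int_automorphism :: "('a::field gauss \<Rightarrow> 'a gauss) \<Rightarrow> bool" where
  "int_automorphism \<phi> \<longleftrightarrow>
     bij \<phi> \<and>
     (\<forall>u v. int_dist (\<phi> u) (\<phi> v) = int_dist u v) \<and>
     (\<forall>u w. \<exists>u' w'. \<phi> ` gauss_line u w = gauss_line u' w')"

definition isomorphic_point_sets :: "'a::field gauss set \<Rightarrow> 'a gauss set \<Rightarrow> bool" where
  "isomorphic_point_sets P Q \<longleftrightarrow> (\<exists>\<phi>. int_automorphism \<phi> \<and> \<phi> ` P = Q)"

end

theory Submission
  imports "HOL-Algebra.Algebraic_Closure_Type" Defs
begin

text \<open>
  If \<open>q \<equiv> 3 (mod 4)\<close>, then \<open>F[i]\<close> is the field of order \<open>q\<^sup>2\<close> and two points are at integral distance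
  iff their difference is a square there, so Blokhuis' theorem on cliques of size \<open>q\<close> in the Paley
  graph applies: normalised to contain 0 and 1, such a clique is the subfield of order \<open>q\<close>, because
  the polynomial with the clique as its roots and the one of the inverted clique are both lacunary.

  If \<open>q = p \<equiv> 1 (mod 4)\<close>, then \<open>F[i] \<cong> F \<times> F\<close> with norm \<open>x y\<close>, so no non-square slope occurs among
  the differences. Projecting along a non-square slope turns the set into the graph of a polynomial
  \<open>f\<close>. With \<open>n = (p - 1) / 2\<close>, the power sums of degree below \<open>n\<close> vanish, which leaves \<open>f\<close> linear or
  \<open>f = c (X - u) ^ (n + 1) + a X + b\<close> (Redei, Lovasz--Schrijver). In the second case the set is a
  union of two half lines, and the power sums of degree \<open>n\<close> force them to lie on the two isotropic
  lines through a point.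
\<close>

section \<open>Roots and coefficients of polynomials over a field\<close>

lemma card_power_eq_le:
  fixes c :: "'a::field"
  assumes "k > 0"
  shows "finite {z. z ^ k = c}" "card {z. z ^ k = c} \<le> k"
proof -
  let ?f = "monom 1 k - [:c:] :: 'a poly"
  have "coeff ?f k = 1" using assms by (simp add: coeff_pCons split: nat.splits)
  then have nz: "?f \<noteq> 0" by (metis coeff_0 zero_neq_one)
  have roots: "{z. z ^ k = c} = {z. poly ?f z = 0}" by (simp add: poly_monom)
  show "finite {z. z ^ k = c}" unfolding roots by (rule poly_roots_finite[OF nz])
  have "degree ?f \<le> k" by (intro degree_diff_le) (auto simp: degree_monom_le)
  with card_poly_roots_bound[OF nz] show "card {z. z ^ k = c} \<le> k" unfolding roots by linarith
qed

text \<open>The difference of two monic polynomials of equal degree drops in degree, yet vanishes on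
  all of \<open>A\<close>. For empty \<open>A\<close> no drop is available, and both are the
  constant 1.\<close>

lemma monic_eq_prod_roots:
  fixes f :: "'a::field poly"
  assumes "lead_coeff f = 1" "card A = degree f" "finite A" "\<And>z. z \<in> A \<Longrightarrow> poly f z = 0"
  shows "f = (\<Prod>z\<in>A. [:- z, 1:])"
proof (rule ccontr)
  let ?g = "\<Prod>z\<in>A. [:- z, 1:]"
  assume ne: "f \<noteq> ?g"
  have dg: "degree ?g = card A"
    by (subst degree_prod_sum_eq) auto
  have lg: "lead_coeff ?g = 1" by (simp add: lead_coeff_prod)
  have r: "A \<subseteq> {z. poly (f - ?g) z = 0}"
    using assms(3,4) by (auto simp: poly_prod)
  have "degree (f - ?g) < card A \<or> card A = 0"
  proof (cases "card A = 0")
    case False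
    have "coeff (f - ?g) (card A) = 0" using lg dg assms(1,2) by simp
    moreover have "degree (f - ?g) \<le> card A"
      using dg assms(2) by (intro degree_diff_le) auto
    ultimately show ?thesis using ne
      by (metis eq_iff_diff_eq_0 le_neq_implies_less leading_coeff_0_iff)
  qed simp
  moreover have "card A \<le> degree (f - ?g)"
    using card_mono[OF poly_roots_finite r] card_poly_roots_bound[of "f - ?g"] ne by force
  ultimately have c0: "card A = 0" by linarith
  then have "degree f = 0" "degree ?g = 0" using dg assms(2) by simp_all
  with lg assms(1) have "f = ?g" by (metis degree_eq_zeroE lead_coeff_pCons(2) pCons_0_0 pCons_eq_iff coeff_pCons_0)
  with ne show False ..
qed

text \<open>Jointly in the variable and \<open>\<nu>\<close>, a product of linear factors has total
  degree at most \<open>card I\<close>. The guard \<open>c j \<noteq> 0\<close> matters: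
  \<open>degree 0 = 0\<close> would break the bound for \<open>j > card I\<close>.\<close>

lemma coeff_prod_linear_param:
  fixes a b :: "'i \<Rightarrow> 'a::field"
  assumes "finite I"
  shows "\<exists>c. (\<forall>j. c j \<noteq> 0 \<longrightarrow> degree (c j) + j \<le> card I) \<and>
    (\<forall>\<nu> j. coeff (\<Prod>i\<in>I. [:- (a i + \<nu> * b i), 1:]) j = poly (c j) \<nu>)"
  using assms
proof (induction I)
  case empty
  show ?case
    by (rule exI[of _ "\<lambda>j. if j = 0 then 1 else 0"]) (auto simp: coeff_eq_0)
next
  case (insert i I)
  then obtain c where c: "\<And>j. c j \<noteq> 0 \<Longrightarrow> degree (c j) + j \<le> card I"
    "\<And>\<nu> j. coeff (\<Prod>i\<in>I. [:- (a i + \<nu> * b i), 1:]) j = poly (c j) \<nu>" by blast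
  define c' where "c' j = [:- a i, - b i:] * c j + (case j of 0 \<Rightarrow> 0 | Suc k \<Rightarrow> c k)" for j
  have "degree (c' j) + j \<le> card (insert i I)" if nz: "c' j \<noteq> 0" for j
  proof -
    have ci: "card (insert i I) = Suc (card I)" using insert.hyps by simp
    have d1: "degree ([:- a i, - b i:] * c j) + j \<le> Suc (card I)" if "c j \<noteq> 0"
      using c(1)[OF that] degree_mult_le[of "[:- a i, - b i:]" "c j"] degree_pCons_le[of "- a i" "[:- b i:]"]
      by simp
    show ?thesis
    proof (cases j)
      case 0
      then show ?thesis using d1 nz ci by (cases "c j = 0") (auto simp: c'_def)
    next
      case (Suc k)
      show ?thesis
      proof (cases "c j = 0")
        case True
        then show ?thesis using c(1)[of k] nz Suc ci by (auto simp: c'_def)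
      next
        case False
        have "degree (c k) + j \<le> Suc (card I) \<or> c k = 0" using c(1)[of k] Suc by auto
        then have "degree (c k) \<le> Suc (card I) - j" using d1[OF False] by auto
        then have "degree (c' j) \<le> Suc (card I) - j"
          unfolding c'_def using d1[OF False] Suc by (intro degree_add_le) auto
        then show ?thesis using d1[OF False] ci by linarith
      qed
    qed
  qed
  moreover have "coeff (\<Prod>i\<in>insert i I. [:- (a i + \<nu> * b i), 1:]) j = poly (c' j) \<nu>" for \<nu> j
    using insert.hyps
    by (cases j) (simp_all add: c'_def c(2)[symmetric] ring_distribs)
  ultimately show ?case by blast
qed

text \<open>Frobenius is additive, so \<open>f ^ q\<close> only has exponents divisible by
  \<open>q\<close>, carrying the \<open>q\<close>-th powers of the coefficients of
  \<open>f\<close>.\<close>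

lemma coeff_char_power:
  fixes f :: "'a::field poly"
  assumes "prime CHAR('a)" "q = CHAR('a) ^ r"
  shows "coeff (f ^ q) (q * i) = coeff f i ^ q"
proof -
  have q0: "q > 0" using assms by (simp add: prime_gt_0_nat)
  have "f ^ q = (\<Sum>i\<le>degree f. monom (coeff f i) i) ^ q" by (simp add: poly_as_sum_of_monoms)
  also have "\<dots> = (\<Sum>i\<le>degree f. monom (coeff f i) i ^ q)"
    using assms by (intro freshmans_dream_sum'[where n = r]) auto
  finally have "coeff (f ^ q) (q * i) = (\<Sum>k\<le>degree f. coeff (monom (coeff f k ^ q) (k * q)) (q * i))"
    by (simp add: coeff_sum monom_power mult.commute)
  also have "\<dots> = (\<Sum>k\<le>degree f. if k = i then coeff f k ^ q else 0)"
    using q0 by (intro sum.cong) (auto simp: mult.commute)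
  also have "\<dots> = coeff f i ^ q"
    using q0 by (auto simp: coeff_eq_0)
  finally show ?thesis .
qed

section \<open>Cliques of the Paley graph of order \<open>q\<^sup>2\<close>\<close>

text \<open>With \<open>K\<close> the subfield of order \<open>q\<^sup>2\<close>, every non-square \<open>\<nu>\<close> of \<open>K\<close> makes
  \<open>(x, y) \<mapsto> x + \<nu> y\<close> a bijection from \<open>S \<times> S\<close> to \<open>K\<close>, so that
  \<open>\<Prod>(T - x - \<nu> y) = T ^ q\<^sup>2 - T\<close>. The coefficients are polynomials in \<open>\<nu>\<close>; those with more
  roots than their degree vanish also at \<open>\<nu> = 0\<close>.\<close>

lemma square_clique_lacunary:
  fixes S :: "'a::field set"
  assumes char: "prime CHAR('a)" "q = CHAR('a) ^ r" and "odd q" "q > 1"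
    and K: "card {z::'a. z ^ q\<^sup>2 = z} = q\<^sup>2"
    and SK: "\<And>x. x \<in> S \<Longrightarrow> x ^ q\<^sup>2 = x" and "card S = q"
    and sq: "\<And>x y. x \<in> S \<Longrightarrow> y \<in> S \<Longrightarrow> x \<noteq> y \<Longrightarrow> (x - y) ^ ((q\<^sup>2 - 1) div 2) = 1"
    and i: "q < 2 * i" "i < q"
  shows "coeff (\<Prod>x\<in>S. [:- x, 1:]) i = 0"
proof -
  define M where "M = (q\<^sup>2 - 1) div 2"
  define K where "K = {z::'a. z ^ q\<^sup>2 = z}"
  \<comment> \<open>The non-squares of \<open>K\<close>. Of the \<open>2 * M\<close> nonzero
    elements at most \<open>M\<close> satisfy \<open>z ^ M = 1\<close>, so at least \<open>M\<close>
    remain.\<close>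
  define V where "V = K - {0} - {z. z ^ M = 1}"
  have q2: "q\<^sup>2 = 2 * M + 1" using \<open>odd q\<close> by (simp add: M_def)
  have "q\<^sup>2 > 1" using \<open>q > 1\<close> by (simp add: one_less_power del: One_nat_def)
  then have M0: "M > 0" using q2 by simp
  have finS: "finite S" using \<open>card S = q\<close> \<open>q > 1\<close> card.infinite by fastforce
  have cK: "card K = q\<^sup>2" using K by (simp add: K_def)
  then have finK: "finite K" using \<open>q\<^sup>2 > 1\<close> card.infinite by fastforce
  have q2char: "q\<^sup>2 = CHAR('a) ^ (2 * r)" using char by (simp add: power_mult[symmetric] power2_eq_square mult_2 power_add)
  have cV: "M \<le> card V"
  proof -
    have "0 \<in> K" using \<open>q > 1\<close> by (simp add: K_def)
    then have "card (K - {0}) = 2 * M" using cK q2 finK by simp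
    moreover have "card (K - {0}) - card {z::'a. z ^ M = 1} \<le> card V"
      unfolding V_def by (rule diff_card_le_card_Diff) (use card_power_eq_le[OF M0] in blast)
    ultimately show ?thesis using card_power_eq_le(2)[OF M0, of "1::'a"] by linarith
  qed
  have prodV: "(\<Prod>p\<in>S \<times> S. [:- (fst p + \<nu> * snd p), 1:]) = monom 1 (q\<^sup>2) - [:0, 1:]" if "\<nu> \<in> V" for \<nu>
  proof -
    have \<nu>: "\<nu> \<in> K" "\<nu> \<noteq> 0" "\<nu> ^ M \<noteq> 1" using that by (auto simp: V_def)
    \<comment> \<open>A collision would make \<open>\<nu>\<close> a quotient of two differences of
      \<open>S\<close>, hence a solution of \<open>\<nu> ^ M = 1\<close>.\<close>
    have inj: "inj_on (\<lambda>p. fst p + \<nu> * snd p) (S \<times> S)"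
    proof (rule inj_onI, clarsimp)
      fix x y x' y' assume S: "x \<in> S" "y \<in> S" "x' \<in> S" "y' \<in> S"
        and "x + \<nu> * y = x' + \<nu> * y'"
      then have e: "x - x' = \<nu> * (y' - y)" by (simp add: algebra_simps)
      show "x = x' \<and> y = y'"
      proof (cases "y = y'")
        case False
        then have "x \<noteq> x'" using e \<nu> by auto
        have "1 = (x - x') ^ M" using sq[OF S(1,3) \<open>x \<noteq> x'\<close>] by (simp add: M_def)
        also have "\<dots> = \<nu> ^ M * (y' - y) ^ M" by (simp add: e power_mult_distrib)
        also have "(y' - y) ^ M = 1" using sq[OF S(4,2)] False by (simp add: M_def)
        finally show ?thesis using \<nu> by simp
      qed (use e in simp)
    qed
    have "(\<lambda>p. fst p + \<nu> * snd p) ` (S \<times> S) \<subseteq> K"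
      using SK \<nu>(1) freshmans_dream'[OF char(1) q2char]
      by (auto simp: K_def power_mult_distrib)
    moreover have "card ((\<lambda>p. fst p + \<nu> * snd p) ` (S \<times> S)) = card K"
      using inj \<open>card S = q\<close> cK by (simp add: card_image card_cartesian_product power2_eq_square)
    ultimately have img: "(\<lambda>p. fst p + \<nu> * snd p) ` (S \<times> S) = K"
      using finK card_subset_eq by blast
    have "(\<Prod>p\<in>S \<times> S. [:- (fst p + \<nu> * snd p), 1:]) = (\<Prod>z\<in>K. [:- z, 1:])"
      unfolding img[symmetric] by (subst prod.reindex[OF inj]) simp
    also have "\<dots> = monom 1 (q\<^sup>2) - [:0, 1:]"
    proof (rule monic_eq_prod_roots[symmetric])
      have d: "degree (monom (1::'a) (q\<^sup>2) - [:0, 1:]) = q\<^sup>2"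
        using \<open>q\<^sup>2 > 1\<close> unfolding diff_conv_add_uminus by (subst degree_add_eq_left) (auto simp: degree_monom_eq)
      then show "lead_coeff (monom (1::'a) (q\<^sup>2) - [:0, 1:]) = 1"
        using \<open>q\<^sup>2 > 1\<close> by (auto simp: coeff_pCons split: nat.splits)
      show "card K = degree (monom (1::'a) (q\<^sup>2) - [:0, 1:])" using d cK by simp
    qed (use finK in \<open>auto simp: K_def poly_monom\<close>)
    finally show ?thesis .
  qed
  obtain c where c: "\<And>j. c j \<noteq> 0 \<Longrightarrow> degree (c j) + j \<le> card (S \<times> S)"
    "\<And>\<nu> j. coeff (\<Prod>p\<in>S \<times> S. [:- (fst p + \<nu> * snd p), 1:]) j = poly (c j) \<nu>"
    using coeff_prod_linear_param[of "S \<times> S" fst snd] finS by blast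
  \<comment> \<open>By \<open>q < 2 * i\<close>, the degree bound \<open>q\<^sup>2 - q * i\<close>
    for \<open>c (q * i)\<close> falls below \<open>M\<close>, while all elements of
    \<open>V\<close> are roots.\<close>
  have iq: "q\<^sup>2 < M + q * i"
  proof -
    have "q + 1 \<le> 2 * i" using i by simp
    then have "q * (q + 1) \<le> q * (2 * i)" by (rule mult_le_mono2)
    then show ?thesis using q2 \<open>q > 1\<close> by (simp add: power2_eq_square)
  qed
  have c0: "c (q * i) = 0"
  proof (rule ccontr)
    assume nz: "c (q * i) \<noteq> 0"
    have "V \<subseteq> {\<nu>. poly (c (q * i)) \<nu> = 0}"
    proof clarify
      fix \<nu> assume "\<nu> \<in> V"
      have "1 < q * i" "q * i < q\<^sup>2"
        using i \<open>q > 1\<close> less_1_mult[of q i] by (auto simp: power2_eq_square)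
      then show "poly (c (q * i)) \<nu> = 0"
        unfolding c(2)[symmetric] prodV[OF \<open>\<nu> \<in> V\<close>]
        by (auto simp: coeff_pCons split: nat.splits)
    qed
    then have "card V \<le> degree (c (q * i))"
      using card_mono[OF poly_roots_finite[OF nz]] card_poly_roots_bound[OF nz] order_trans by blast
    with c(1)[OF nz] cV iq \<open>card S = q\<close> show False
      by (simp add: card_cartesian_product power2_eq_square)
  qed
  \<comment> \<open>At \<open>\<nu> = 0\<close> the factors no longer depend on the second
    component, and the product collapses to a \<open>q\<close>-th power.\<close>
  have "(\<Prod>x\<in>S. [:- x, 1:]) ^ q = (\<Prod>x\<in>S. \<Prod>y\<in>S. [:- x, 1:])"
    using \<open>card S = q\<close> by (simp add: prod_power_distrib)
  also have "\<dots> = (\<Prod>p\<in>S \<times> S. [:- (fst p + 0 * snd p), 1:])"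
    unfolding prod.cartesian_product by (intro prod.cong) auto
  finally have "(\<Prod>x\<in>S. [:- x, 1:]) ^ q = (\<Prod>p\<in>S \<times> S. [:- (fst p + 0 * snd p), 1:])" .
  then have "coeff ((\<Prod>x\<in>S. [:- x, 1:]) ^ q) (q * i) = 0"
    using c(2)[of 0 "q * i"] c0 by simp
  then show ?thesis using coeff_char_power[OF char] by simp
qed

text \<open>Applied to \<open>S\<close> and to its inversion \<open>{0} \<union> {1 / x | x \<in> S - {0}}\<close>, the vanishing
  result leaves only \<open>T ^ q + c T\<close>.\<close>

theorem square_clique_eq_subfield:
  fixes S :: "'a::field set"
  assumes char: "prime CHAR('a)" "q = CHAR('a) ^ r" and "odd q" "q > 1"
    and K: "card {z::'a. z ^ q\<^sup>2 = z} = q\<^sup>2"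
    and SK: "\<And>x. x \<in> S \<Longrightarrow> x ^ q\<^sup>2 = x" and cS: "card S = q"
    and sq: "\<And>x y. x \<in> S \<Longrightarrow> y \<in> S \<Longrightarrow> x \<noteq> y \<Longrightarrow> (x - y) ^ ((q\<^sup>2 - 1) div 2) = 1"
    and S01: "0 \<in> S" "1 \<in> S"
  shows "S \<subseteq> {z. z ^ q = z}"
proof -
  have finS: "finite S" using cS \<open>q > 1\<close> card.infinite by fastforce
  \<comment> \<open>Splitting off the root 0 leaves \<open>H\<close> with nonzero constant term, so
    that reversing its coefficients keeps the degree. Coefficients shift by one, whence the
    \<open>i + 1\<close> below.\<close>
  define Z where "Z = S - {0}"
  define H where "H = (\<Prod>x\<in>Z. [:- x, 1:])"
  have finZ: "finite Z" and Z0: "0 \<notin> Z" and cZ: "card Z = q - 1" and SZ: "S = insert 0 Z"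
    using finS S01 cS by (auto simp: Z_def)
  have H0: "coeff H 0 \<noteq> 0"
    using Z0 finZ by (simp add: H_def poly_0_coeff_0[symmetric] poly_prod)
  have dH: "degree H = q - 1"
    unfolding H_def by (subst degree_prod_sum_eq) (auto simp: cZ)
  have lH: "lead_coeff H = 1" by (simp add: H_def lead_coeff_prod)
  have coH: "coeff H i = 0" if "q < 2 * (i + 1)" "i + 1 < q" for i
  proof -
    have "coeff (\<Prod>x\<in>S. [:- x, 1:]) (Suc i) = 0"
      using that by (intro square_clique_lacunary[OF char \<open>odd q\<close> \<open>q > 1\<close> K SK cS sq]) auto
    moreover have "(\<Prod>x\<in>S. [:- x, 1:]) = [:0, 1:] * H"
      unfolding SZ H_def using finZ Z0 by simp
    ultimately show ?thesis by simp
  qed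
  define Y where "Y = inverse ` Z"
  define G where "G = (\<Prod>x\<in>Y. [:- x, 1:])"
  have injinv: "inj_on inverse Z" by (auto simp: inj_on_def)
  have Y0: "0 \<notin> Y" "finite Y" using Z0 finZ by (auto simp: Y_def)
  have coG: "coeff G i = 0" if "q < 2 * (i + 1)" "i + 1 < q" for i
  proof -
    have Y: "\<And>x. x \<in> insert 0 Y \<Longrightarrow> x ^ q\<^sup>2 = x" "card (insert 0 Y) = q"
      using SK cZ Y0 \<open>q > 1\<close> injinv by (auto simp: Y_def Z_def power_inverse card_image)
    have m1: "(-1::'a) ^ ((q\<^sup>2 - 1) div 2) = 1"
      using sq[OF S01] by simp
    have "(x - y) ^ ((q\<^sup>2 - 1) div 2) = 1" if xy: "x \<in> insert 0 Y" "y \<in> insert 0 Y" "x \<noteq> y" for x y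
    proof -
      have inv: "inverse u ^ ((q\<^sup>2 - 1) div 2) = 1" if "u \<in> Z" for u
        using sq[of u 0] that S01 by (auto simp: Z_def power_inverse)
      consider "x = 0" "y \<in> Y" | "y = 0" "x \<in> Y" | "x \<in> Y" "y \<in> Y" using xy by auto
      then show ?thesis
      proof cases
        case 1
        then show ?thesis using inv m1 power_mult_distrib[of "-1" y]
          by (auto simp: Y_def)
      next
        case 2
        then show ?thesis using inv by (auto simp: Y_def)
      next
        case 3
        then obtain u v where uv: "u \<in> Z" "v \<in> Z" "x = inverse u" "y = inverse v"
          by (auto simp: Y_def)
        then have "u \<noteq> 0" "v \<noteq> 0" "u \<noteq> v" using Z0 xy by auto
        then have "x - y = (v - u) * inverse u * inverse v" using uv by (simp add: field_simps)
        then show ?thesis using inv uv sq[of v u] \<open>u \<noteq> v\<close>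
          by (simp add: power_mult_distrib Z_def)
      qed
    qed
    then have "coeff (\<Prod>x\<in>insert 0 Y. [:- x, 1:]) (Suc i) = 0"
      using that by (intro square_clique_lacunary[OF char \<open>odd q\<close> \<open>q > 1\<close> K Y]) auto
    moreover have "(\<Prod>x\<in>insert 0 Y. [:- x, 1:]) = [:0, 1:] * G"
      unfolding G_def using Y0 by simp
    ultimately show ?thesis by simp
  qed
  \<comment> \<open>Reversing the coefficients inverts the roots, so the lower coefficients of
    \<open>H\<close> are, up to a factor, the upper ones of \<open>G\<close>.\<close>
  have rfl: "reflect_poly H = smult (coeff H 0) G"
  proof -
    have lin: "reflect_poly [:- x, 1:] = smult (- x) [:- inverse x, 1:]" if "x \<in> Z" for x
    proof -
      have "x \<noteq> 0" using that Z0 by blast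
      then show ?thesis by (simp add: reflect_poly_pCons)
    qed
    have "reflect_poly H = (\<Prod>x\<in>Z. reflect_poly [:- x, 1:])"
      unfolding H_def by (rule reflect_poly_prod)
    also have "\<dots> = (\<Prod>x\<in>Z. smult (- x) [:- inverse x, 1:])"
      by (intro prod.cong refl lin)
    also have "\<dots> = smult (\<Prod>x\<in>Z. - x) (\<Prod>x\<in>Z. [:- inverse x, 1:])"
      by (rule prod_smult)
    also have "(\<Prod>x\<in>Z. - x) = coeff H 0"
      by (simp add: H_def poly_0_coeff_0[symmetric] poly_prod)
    also have "(\<Prod>x\<in>Z. [:- inverse x, 1:]) = G"
      unfolding G_def Y_def by (subst prod.reindex[OF injinv]) simp
    finally show ?thesis .
  qed
  have mid: "coeff H i = 0" if i: "0 < i" "i < q - 1" for i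
  proof (cases "q < 2 * (i + 1)")
    case True
    then show ?thesis using coH i by simp
  next
    case False
    have "coeff H i = coeff (reflect_poly H) (q - 1 - i)"
      using i by (simp add: coeff_reflect_poly dH)
    also have "\<dots> = 0"
      unfolding rfl using coG[of "q - 1 - i"] False i by simp
    finally show ?thesis .
  qed
  have Heq: "H = monom 1 (q - 1) + [:coeff H 0:]"
  proof (rule poly_eqI)
    fix i
    consider "i = 0" | "0 < i" "i < q - 1" | "i = q - 1" "i > 0" | "i > q - 1" by linarith
    then show "coeff H i = coeff (monom 1 (q - 1) + [:coeff H 0:]) i"
      using \<open>q > 1\<close> mid dH lH coeff_eq_0[of H i]
      by cases (auto simp: coeff_pCons split: nat.splits)
  qed
  have root: "poly H x = 0" if "x \<in> Z" for x
    using that finZ by (auto simp: H_def poly_prod)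
  have ph: "poly H x = x ^ (q - 1) + coeff H 0" for x
    by (subst Heq) (simp add: poly_monom)
  \<comment> \<open>The root 1 fixes the constant term, so all roots are \<open>(q - 1)\<close>-st
    roots of unity.\<close>
  have "coeff H 0 = -1" using root[of 1] ph[of 1] S01
    by (simp add: Z_def eq_neg_iff_add_eq_0 add.commute)
  then have "x ^ (q - 1) = 1" if "x \<in> Z" for x using root[OF that] ph[of x] by simp
  then have "x ^ q = x" if "x \<in> Z" for x
    using that \<open>q > 1\<close> by (metis One_nat_def Suc_pred mult.right_neutral not_one_less_zero neq0_conv power_Suc)
  then show ?thesis using SZ \<open>q > 1\<close> by auto
qed

section \<open>Power sums and squares in finite fields\<close>

text \<open>Adding 1 permutes the ring, so the sum of all elements equals itself plus the number of
  elements.\<close>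

lemma of_nat_card_UNIV: "of_nat (card (UNIV :: 'a::{ring_1,finite} set)) = (0::'a)"
proof -
  have "(\<Sum>x\<in>UNIV. x + 1) = (\<Sum>x\<in>(UNIV :: 'a set). x)"
    by (rule sum.reindex_bij_witness[of _ "\<lambda>x. x - 1" "\<lambda>x. x + 1"]) auto
  then show ?thesis by (simp add: sum.distrib)
qed

text \<open>Multiplication by \<open>x\<close> permutes the nonzero elements, and their nonzero
  product cancels.\<close>

lemma power_card_UNIV_minus_1:
  fixes x :: "'a::{field,finite}"
  assumes "x \<noteq> 0"
  shows "x ^ (card (UNIV :: 'a set) - 1) = 1"
proof -
  have "(\<Prod>y\<in>UNIV - {0}. x * y) = (\<Prod>y\<in>UNIV - {0}. y)"
    by (rule prod.reindex_bij_witness[of _ "\<lambda>y. y / x" "\<lambda>y. x * y"]) (use assms in auto)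
  then show ?thesis by (simp add: prod.distrib)
qed

text \<open>If \<open>g ^ k \<noteq> 1\<close> for some nonzero \<open>g\<close>, scaling by
  \<open>g\<close> forces the sum to be 0. For \<open>k = 0\<close> the convention
  \<open>0 ^ 0 = 1\<close> makes the sum the order of the field, which is 0 there. The bound on
  \<open>k\<close> stops before the exponent where the value -1 recurs.\<close>

lemma sum_power_UNIV:
  assumes "k < 2 * (card (UNIV :: 'a::{field,finite} set) - 1)"
  shows "(\<Sum>u\<in>(UNIV :: 'a set). u ^ k) = (if k = card (UNIV :: 'a set) - 1 then -1 else 0)"
proof -
  define Q where "Q = card (UNIV :: 'a set) - 1"
  have Q: "card (UNIV :: 'a set) = Suc Q" "x ^ Q = 1" if "x \<noteq> 0" for x :: 'a
    using power_card_UNIV_minus_1[OF that] finite_UNIV_card_ge_0[where ?'a = 'a] by (auto simp: Q_def)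
  have Q0: "Q > 0" using assms by (simp add: Q_def)
  have small: "(\<Sum>u\<in>(UNIV :: 'a set). u ^ k) = 0" if "0 < k" "k < Q" for k
  proof -
    have "\<not> UNIV - {0} \<subseteq> {z::'a. z ^ k = 1}"
    proof
      assume "UNIV - {0} \<subseteq> {z::'a. z ^ k = 1}"
      then have "card (UNIV - {0::'a}) \<le> k"
        using card_mono[OF card_power_eq_le(1)] card_power_eq_le(2)[of k "1::'a"] \<open>0 < k\<close> order_trans by blast
      then show False using \<open>k < Q\<close> by (simp add: Q_def)
    qed
    then obtain g :: 'a where g: "g \<noteq> 0" "g ^ k \<noteq> 1" by blast
    have "(\<Sum>u\<in>(UNIV :: 'a set). (g * u) ^ k) = (\<Sum>u\<in>(UNIV :: 'a set). u ^ k)"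
      by (rule sum.reindex_bij_witness[of _ "\<lambda>y. y / g" "\<lambda>y. g * y"]) (use g in auto)
    then have "(g ^ k - 1) * (\<Sum>u\<in>(UNIV :: 'a set). u ^ k) = 0"
      by (simp add: power_mult_distrib sum_distrib_left[symmetric] left_diff_distrib)
    then show ?thesis using g by simp
  qed
  have eqQ: "(\<Sum>u\<in>(UNIV :: 'a set). u ^ Q) = -1"
  proof -
    have "(\<Sum>u\<in>(UNIV :: 'a set). u ^ Q) = (\<Sum>u\<in>UNIV - {0 :: 'a}. u ^ Q)"
      using Q0 by (intro sum.mono_neutral_right) auto
    also have "\<dots> = of_nat Q"
      using Q by (simp add: Q_def)
    also have "\<dots> = -1"
      using of_nat_card_UNIV[where ?'a = 'a] Q(1)[of 1] by (simp add: eq_neg_iff_add_eq_0 add.commute)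
    finally show ?thesis .
  qed
  consider "k = 0" | "0 < k" "k < Q" | "k = Q" | "Q < k" by linarith
  then show ?thesis
  proof cases
    case 1
    then show ?thesis using of_nat_card_UNIV[where ?'a = 'a] Q0 by (simp add: Q_def)
  next
    case 4
    have "(\<Sum>u\<in>(UNIV :: 'a set). u ^ k) = (\<Sum>u\<in>(UNIV :: 'a set). u ^ (k - Q))"
    proof (intro sum.cong refl)
      fix u :: 'a
      have "u ^ k = u ^ Q * u ^ (k - Q)" using 4 by (simp flip: power_add)
      then show "u ^ k = u ^ (k - Q)" using Q(2)[of u] 4 Q0 by (cases "u = 0") auto
    qed
    then show ?thesis using small[of "k - Q"] 4 assms by (simp add: Q_def)
  qed (use small eqQ in \<open>auto simp: Q_def\<close>)
qed

lemma sum_poly_UNIV: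
  fixes f :: "'a::{field,finite} poly"
  assumes "degree f < 2 * (card (UNIV :: 'a set) - 1)"
  shows "(\<Sum>u\<in>UNIV. poly f u) = - coeff f (card (UNIV :: 'a set) - 1)"
proof -
  let ?Q = "card (UNIV :: 'a set) - 1"
  have "(\<Sum>u\<in>UNIV. poly f u) = (\<Sum>i\<le>degree f. coeff f i * (\<Sum>u\<in>UNIV. u ^ i))"
    unfolding poly_altdef sum_distrib_left by (rule sum.swap)
  also have "\<dots> = (\<Sum>i\<le>degree f. if i = ?Q then - coeff f i else 0)"
    by (intro sum.cong refl, subst sum_power_UNIV) (use assms in auto)
  also have "\<dots> = - coeff f ?Q"
    by (auto simp: coeff_eq_0)
  finally show ?thesis .
qed

text \<open>For a field of order \<open>q\<close>, the polynomial
  \<open>1 - (X - c) ^ (q - 1)\<close> is 1 at \<open>c\<close> and 0 elsewhere.\<close>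

lemma finite_field_interpolation:
  fixes g :: "'a::{field,finite} \<Rightarrow> 'a"
  obtains f where "degree f \<le> card (UNIV :: 'a set) - 1" "\<And>u. poly f u = g u"
proof
  let ?Q = "card (UNIV :: 'a set) - 1"
  let ?f = "\<Sum>c\<in>UNIV. smult (g c) (1 - [:- c, 1:] ^ ?Q)"
  have "degree ([:- c, 1:] ^ ?Q) \<le> ?Q" for c :: 'a
    using degree_power_le[of "[:- c, 1:]" ?Q] by simp
  then show "degree ?f \<le> ?Q"
    by (intro degree_sum_le) (auto intro!: order_trans[OF degree_smult_le] degree_diff_le)
  fix u
  have "2 \<le> card (UNIV :: 'a set)"
    using card_mono[of "UNIV :: 'a set" "{0, 1}"] by simp
  then have "poly ?f u = (\<Sum>c\<in>UNIV. if c = u then g c else 0)"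
    unfolding poly_sum by (intro sum.cong) (auto simp: power_card_UNIV_minus_1 simp del: One_nat_def)
  then show "poly ?f u = g u" by simp
qed

section \<open>Squares and Euler's criterion\<close>

lemma zero_in_squares [simp]: "0 \<in> squares"
  unfolding squares_def by (force intro: exI[of _ 0])

lemma mult_in_squares_iff:
  fixes x t :: "'a::field"
  assumes "t \<in> squares" "t \<noteq> 0"
  shows "t * x \<in> squares \<longleftrightarrow> x \<in> squares"
proof -
  obtain s where s: "t = s ^ 2" "s \<noteq> 0" using assms by (auto simp: squares_def)
  have "x = (r / s) ^ 2" if "t * x = r ^ 2" for r
    using that s by (simp add: field_simps)
  moreover have "t * r ^ 2 = (s * r) ^ 2" for r using s by (simp add: power_mult_distrib)
  ultimately show ?thesis unfolding squares_def by blast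
qed

text \<open>Two counts meet: the nonzero squares lie among the at most \<open>n\<close> solutions of
  \<open>z ^ n = 1\<close>, while squaring is at most two-to-one on the \<open>2 * n\<close> nonzero
  elements.\<close>

lemma squares_eq_roots_of_unity:
  assumes q: "card (UNIV :: 'a::{field,finite} set) = 2 * n + 1"
  shows "squares - {0} = {z::'a. z ^ n = 1}"
    and "card (squares - {0::'a}) = n" and "card (- squares :: 'a set) = n"
proof -
  have "n > 0" using card_mono[of "UNIV :: 'a set" "{0, 1}"] q by simp
  have pw: "t ^ (2 * n) = 1" if "t \<noteq> 0" for t :: 'a
    using power_card_UNIV_minus_1[OF that] q by simp
  have sub: "squares - {0} \<subseteq> {z::'a. z ^ n = 1}"
    using pw by (auto simp: squares_def power_mult[symmetric])
  have "UNIV - {0} \<subseteq> (\<Union>s\<in>squares - {0}. {t::'a. t ^ 2 = s})"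
    by (auto simp: squares_def)
  then have "card (UNIV - {0::'a}) \<le> card (\<Union>s\<in>squares - {0}. {t::'a. t ^ 2 = s})"
    by (intro card_mono) auto
  also have "\<dots> \<le> (\<Sum>s\<in>squares - {0}. card {t::'a. t ^ 2 = s})" by (rule card_UN_le) simp
  also have "\<dots> \<le> (\<Sum>s\<in>squares - {0::'a}. 2)"
    by (intro sum_mono card_power_eq_le) simp
  finally have ge: "n \<le> card (squares - {0::'a})" using q by simp
  with card_power_eq_le(2)[OF \<open>n > 0\<close>, of "1::'a"]
  show "squares - {0} = {z::'a. z ^ n = 1}"
    by (intro card_seteq sub card_power_eq_le(1)) (use \<open>n > 0\<close> in linarith)+
  then show c: "card (squares - {0::'a}) = n"
    using ge card_power_eq_le(2)[OF \<open>n > 0\<close>, of "1::'a"] by simp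
  have "card (squares :: 'a set) = n + 1"
    using c \<open>n > 0\<close> card_Diff_singleton[of "0::'a" squares] by simp
  then show "card (- squares :: 'a set) = n"
    using q by (simp add: Compl_eq_Diff_UNIV card_Diff_subset)
qed

lemma squares_iff_power:
  fixes x :: "'a::{field,finite}"
  assumes q: "card (UNIV :: 'a set) = 2 * n + 1" and "x \<noteq> 0"
  shows "x \<in> squares \<longleftrightarrow> x ^ n = 1" "x \<notin> squares \<longleftrightarrow> x ^ n = -1"
proof -
  show iff: "x \<in> squares \<longleftrightarrow> x ^ n = 1"
    using squares_eq_roots_of_unity(1)[OF q] \<open>x \<noteq> 0\<close> by blast
  have "x ^ (2 * n) = 1" using power_card_UNIV_minus_1[OF \<open>x \<noteq> 0\<close>] q by simp
  then have "(x ^ n) ^ 2 = 1" by (simp add: mult.commute flip: power_mult)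
  then have "x ^ n = 1 \<or> x ^ n = -1" by (simp add: power2_eq_1_iff)
  \<comment> \<open>If \<open>2 = 0\<close>, the odd order of the field, which vanishes in it, would
    be 1.\<close>
  moreover have "(1::'a) \<noteq> -1"
  proof
    assume "(1::'a) = -1"
    then have "(2::'a) = 0" by (metis one_add_one add.right_inverse)
    moreover have "of_nat (2 * n + 1) = (0::'a)" using of_nat_card_UNIV[where ?'a = 'a] q by simp
    ultimately show False by simp
  qed
  ultimately show "x \<notin> squares \<longleftrightarrow> x ^ n = -1" using iff by auto
qed

text \<open>The characteristic divides the prime order and so equals it. This makes binomials and
  the factors \<open>n\<close>, \<open>n + 1\<close> and 2 invertible later.\<close>

lemma of_nat_neq_0_below_prime_card:
  assumes "prime (card (UNIV :: 'a::{field,finite} set))" "0 < k" "k < card (UNIV :: 'a set)"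
  shows "(of_nat k :: 'a) \<noteq> 0"
proof
  assume "(of_nat k :: 'a) = 0"
  then have "CHAR('a) dvd k" by (simp add: of_nat_eq_0_iff_char_dvd)
  moreover have "CHAR('a) dvd card (UNIV :: 'a set)"
    using of_nat_card_UNIV[where ?'a = 'a] by (simp add: of_nat_eq_0_iff_char_dvd)
  then have "CHAR('a) = card (UNIV :: 'a set)"
    using assms(1) by (metis CHAR_not_1' One_nat_def prime_nat_iff)
  ultimately show False using assms(2,3) by (simp add: nat_dvd_not_less)
qed

section \<open>Sets of \<open>p\<close> points determining few directions\<close>

text \<open>Distinct points with equal \<open>y - m * x\<close> would be joined by a line of slope
  \<open>m\<close>, making \<open>(x - x') * (y - y')\<close> equal to \<open>m\<close> times a
  nonzero square. Surjectivity follows by counting.\<close>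

lemma slope_bij:
  fixes S :: "('a::{field,finite} \<times> 'a) set"
  assumes "card S = card (UNIV :: 'a set)"
    and clique: "\<And>x y x' y'. (x, y) \<in> S \<Longrightarrow> (x', y') \<in> S \<Longrightarrow> (x - x') * (y - y') \<in> squares"
    and m: "m \<notin> squares"
  shows "bij_betw (\<lambda>(x, y). y - m * x) S UNIV"
proof -
  have inj: "inj_on (\<lambda>(x, y). y - m * x) S"
  proof (rule inj_onI, clarify)
    fix x y x' y' assume S: "(x, y) \<in> S" "(x', y') \<in> S" and "y - m * x = y' - m * x'"
    then have e: "y - y' = m * (x - x')" by (simp add: algebra_simps)
    have "x = x'"
    proof (rule ccontr)
      assume "x \<noteq> x'"
      then have "(x - x') ^ 2 * m \<notin> squares"
        using mult_in_squares_iff[of "(x - x') ^ 2" m] m by (auto simp: squares_def)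
      then show False using clique[OF S] by (simp add: e power2_eq_square mult.assoc mult.commute[of m])
    qed
    with e show "x = x' \<and> y = y'" by simp
  qed
  then have "(\<lambda>(x, y). y - m * x) ` S = UNIV"
    using assms(1) by (intro card_subset_eq) (auto simp: card_image)
  with inj show ?thesis by (simp add: bij_betw_def)
qed

text \<open>For a non-square \<open>m\<close> the values \<open>y - m x\<close> run through the whole field, so their power sums
  vanish. As polynomials in \<open>m\<close> these power sums have the \<open>n\<close> non-squares as roots, which are the
  roots of \<open>X ^ n + 1\<close>.\<close>

lemma clique_power_sums:
  fixes S :: "('a::{field,finite} \<times> 'a) set"
  assumes q: "card (UNIV :: 'a set) = 2 * n + 1" and pr: "prime (2 * n + 1)"
    and cS: "card S = card (UNIV :: 'a set)"
    and clique: "\<And>x y x' y'. (x, y) \<in> S \<Longrightarrow> (x', y') \<in> S \<Longrightarrow> (x - x') * (y - y') \<in> squares"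
    and "i + j < n \<or> i + j = n \<and> 0 < i \<and> 0 < j"
  shows "(\<Sum>(x, y)\<in>S. x ^ i * y ^ j) = 0"
proof -
  define k where "k = i + j"
  have k: "k \<le> n" "i \<le> k" "j = k - i" "k < n \<or> 0 < i \<and> i < n" "n > 0"
    using assms(5) by (auto simp: k_def)
  define a where "a l = of_nat (k choose l) * (-1) ^ l * (\<Sum>(x, y)\<in>S. x ^ l * y ^ (k - l))" for l
  define f where "f = (\<Sum>l\<le>k. monom (a l) l)"
  have cf: "coeff f l = (if l \<le> k then a l else 0)" for l
    by (simp add: f_def coeff_sum)
  \<comment> \<open>Removing a multiple of \<open>X ^ n + 1\<close>, which vanishes on all
    non-squares, kills the coefficient of degree \<open>n\<close>: \<open>R\<close> keeps
    \<open>n\<close> roots but has degree below \<open>n\<close>.\<close>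
  define R where "R = f - smult (coeff f n) (monom 1 n + 1)"
  have root: "poly R m = 0" if m: "m \<notin> squares" for m
  proof -
    have "m \<noteq> 0" using m by auto
    have "poly f m = (\<Sum>l\<le>k. \<Sum>(x, y)\<in>S. of_nat (k choose l) * (- (m * x)) ^ l * y ^ (k - l))"
      unfolding f_def poly_sum poly_monom a_def sum_distrib_left sum_distrib_right
      by (intro sum.cong refl) (auto simp: power_mult_distrib power_minus[of "m * _"])
    also have "\<dots> = (\<Sum>(x, y)\<in>S. \<Sum>l\<le>k. of_nat (k choose l) * (- (m * x)) ^ l * y ^ (k - l))"
      by (subst sum.swap) (simp add: split_beta)
    also have "\<dots> = (\<Sum>p\<in>S. ((\<lambda>(x, y). y - m * x) p) ^ k)"
      by (intro sum.cong refl) (auto simp: binomial_ring[symmetric])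
    also have "\<dots> = (\<Sum>u\<in>UNIV. u ^ k)"
      by (rule sum.reindex_bij_betw[OF slope_bij[OF cS clique m]])
    also have "\<dots> = 0" using k q by (subst sum_power_UNIV) auto
    finally show ?thesis
      using squares_iff_power(2)[OF q \<open>m \<noteq> 0\<close>] m by (simp add: R_def poly_monom)
  qed
  have "R = 0"
  proof (rule ccontr)
    assume nz: "R \<noteq> 0"
    have "degree R \<le> n"
      unfolding R_def using k
      by (intro degree_diff_le order_trans[OF degree_smult_le] degree_add_le)
        (auto simp: degree_monom_le cf intro!: degree_le)
    moreover have "coeff R n = 0" using k by (simp add: R_def coeff_1)
    ultimately have "degree R < n" using nz
      by (metis le_neq_implies_less leading_coeff_0_iff)
    moreover have "n \<le> degree R"
      using card_mono[OF poly_roots_finite[OF nz], of "- squares"] root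
        card_poly_roots_bound[OF nz] squares_eq_roots_of_unity(3)[OF q] by force
    ultimately show False by simp
  qed
  \<comment> \<open>So \<open>f\<close> is a multiple of \<open>X ^ n + 1\<close>, and only its
    coefficients 0 and \<open>n\<close> may survive. This is why both exponents are positive when
    the total degree is \<open>n\<close>.\<close>
  then have "coeff (smult (coeff f n) (monom 1 n + 1)) i = a i"
    using cf[of i] k(2) by (simp add: R_def)
  then have "a i = 0"
    using k by (cases "k < n") (auto simp: cf coeff_1)
  moreover have "(of_nat (k choose i) :: 'a) \<noteq> 0"
  proof
    assume "(of_nat (k choose i) :: 'a) = 0"
    then have "(of_nat (fact k) :: 'a) = 0"
      unfolding binomial_fact_lemma[OF k(2), symmetric] by simp
    then have "\<exists>l\<in>{1..k}. (of_nat l :: 'a) = 0"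
      by (simp add: fact_prod)
    then show False
      using of_nat_neq_0_below_prime_card[where ?'a = 'a] pr q k by force
  qed
  ultimately show ?thesis using k by (simp add: a_def)
qed

text \<open>Summation over the field extracts the coefficient of degree \<open>2 * n\<close> of
  \<open>X ^ l * f ^ k\<close>; the degree bound keeps the exponent \<open>4 * n\<close>
  out.\<close>

lemma low_power_sums_imp_coeff_0:
  fixes f :: "'a::{field,finite} poly"
  assumes q: "card (UNIV :: 'a set) = 2 * n + 1"
    and "(\<Sum>u\<in>UNIV. u ^ l * poly f u ^ k) = 0"
    and "l \<le> 2 * n" "degree (f ^ k) + l < 4 * n"
  shows "coeff (f ^ k) (2 * n - l) = 0"
proof -
  have "degree (monom 1 l * f ^ k) < 2 * (card (UNIV :: 'a set) - 1)"
    using assms degree_mult_le[of "monom 1 l" "f ^ k"] degree_monom_le[of "1::'a" l] by simp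
  from sum_poly_UNIV[OF this] show ?thesis
    using assms by (simp add: poly_monom coeff_monom_mult)
qed

text \<open>The range \<open>3 \<le> degree f \<le> n\<close> is excluded by a power \<open>f ^ k\<close> whose degree lies between \<open>n + k\<close>
  and \<open>2n\<close>; for degree \<open>n + 1\<close> one looks at \<open>f ^ 2\<close>.\<close>

lemma low_power_sums_imp_poly_form:
  fixes f :: "'a::{field,finite} poly"
  assumes q: "card (UNIV :: 'a set) = 2 * n + 1" and pr: "prime (2 * n + 1)" and n: "6 \<le> n"
    and df: "degree f \<le> 2 * n"
    and sums: "\<And>l k. l + k < n \<Longrightarrow> (\<Sum>u\<in>UNIV. u ^ l * poly f u ^ k) = 0"
  shows "degree f \<le> 2 \<or>
    (\<exists>c u a b. c \<noteq> 0 \<and> f = smult c ([:- u, 1:] ^ (n + 1)) + [:b, a:])"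
proof -
  \<comment> \<open>With \<open>l = 2 * n - i\<close> the condition \<open>l + k < n\<close> becomes
    \<open>n + k < i\<close>.\<close>
  have high: "coeff (f ^ k) i = 0" if "n + k < i" "i \<le> 2 * n" "degree (f ^ k) + (2 * n - i) < 4 * n" for k i
    using low_power_sums_imp_coeff_0[OF q sums[of "2 * n - i" k]] that by simp
  have d: "degree f \<le> n + 1"
  proof (rule degree_le, clarify)
    fix i assume "n + 1 < i"
    then show "coeff f i = 0"
      using high[of 1 i] df n by (cases "i \<le> 2 * n") (auto simp: coeff_eq_0)
  qed
  show ?thesis
  proof (cases "degree f \<le> n")
    case True
    have False if "3 \<le> degree f"
    proof -
      define e where "e = degree f - 1"
      have e: "2 \<le> e" "e < n" "degree f = e + 1" using that True by (auto simp: e_def)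
      define t where "t = n div e"
      \<comment> \<open>The least \<open>k\<close> with \<open>e * k > n\<close>, that is, with
        \<open>degree (f ^ k) = (e + 1) * k\<close> above \<open>n + k\<close>.\<close>
      define k where "k = t + 1"
      have et: "e * t \<le> n" by (simp add: t_def)
      have k1: "n < e * k"
        using e dividend_less_div_times[of e n] by (simp add: k_def t_def algebra_simps)
      have k2: "(e + 1) * k \<le> 2 * n"
      proof (cases "2 * e \<le> n")
        case True
        \<comment> \<open>For \<open>e\<close> between 2 and \<open>n / 2\<close> this product
          bounds \<open>e + t\<close> by \<open>n / 2 + 2\<close>; then \<open>6 \<le> n\<close>
          gives \<open>(e + 1) * (t + 1) \<le> 2 * n\<close>.\<close>
        have "0 \<le> (int e - 2) * (int n - 2 * int e)" using e True by simp
        then have "2 * int n \<le> int e * (int n - 2 * int e + 4)" by (simp add: algebra_simps)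
        moreover have "int e * int t \<le> int n" using et by (metis of_nat_mult of_nat_le_iff)
        ultimately have "int e * (2 * int t) \<le> int e * (int n - 2 * int e + 4)" by linarith
        then have "2 * int t \<le> int n - 2 * int e + 4" using e by simp
        then have "2 * (e + t) \<le> n + 4" by presburger
        then have "e * t + (e + t) + 1 \<le> 2 * n" using n et by presburger
        then show ?thesis by (simp add: k_def)
      next
        case False
        then have "t = 1" unfolding t_def using e by (intro div_nat_eqI) auto
        then show ?thesis using e by (simp add: k_def)
      qed
      have dk: "degree (f ^ k) = (e + 1) * k" using e by (subst degree_power_eq) auto
      have "coeff (f ^ k) ((e + 1) * k) = 0"
        using k1 k2 n by (intro high) (auto simp: dk algebra_simps)
      then have "f ^ k = 0" by (metis dk leading_coeff_0_iff)
      then show False using e by auto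
    qed
    then show ?thesis by fastforce
  next
    case False
    with d have df: "degree f = n + 1" by simp
    define c where "c = coeff f (n + 1)"
    have c0: "c \<noteq> 0" using df by (metis Suc_eq_plus1 c_def leading_coeff_0_iff degree_0 nat.distinct(1))
    define N where "N = (of_nat (n + 1) :: 'a)"
    have n1: "N \<noteq> 0" and two: "(2::'a) \<noteq> 0"
      using of_nat_neq_0_below_prime_card[where ?'a = 'a, of "n + 1"]
        of_nat_neq_0_below_prime_card[where ?'a = 'a, of 2] pr q n by (auto simp: N_def)
    \<comment> \<open>The shift makes \<open>c * (X - u) ^ (n + 1)\<close> agree with
      \<open>f\<close> also in degree \<open>n\<close>.\<close>
    define u where "u = - coeff f n / (N * c)"
    define L where "L = [:- u, 1:] ^ (n + 1)"
    define g where "g = f - smult c L"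
    have dL: "degree L = n + 1" and lL: "coeff L (n + 1) = 1"
      unfolding L_def by (rule degree_linear_power, rule coeff_linear_power)
    have "coeff L n = N * (- u)"
      unfolding L_def N_def using coeff_linear_poly_power[of n "n + 1" "- u" 1] by simp
    then have "coeff g n = 0"
      using c0 n1 by (simp add: g_def u_def)
    moreover have "coeff g (n + 1) = 0" using lL by (simp add: g_def c_def)
    moreover have "degree g \<le> n + 1" unfolding g_def using df dL
      by (intro degree_diff_le order_trans[OF degree_smult_le]) auto
    ultimately have cg: "coeff g i = 0" if "n \<le> i" for i
      using that coeff_eq_0[of g i] by (cases "i = n"; cases "i = n + 1") auto
    then have "degree g \<le> n - 1" using n by (intro degree_le) auto
    then have dg: "degree g < n" using n by simp
    have fg: "f = smult c L + g" by (simp add: g_def)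
    have "degree g \<le> 1"
    proof (rule ccontr)
      assume "\<not> degree g \<le> 1"
      \<comment> \<open>In degree \<open>e\<close> of \<open>f ^ 2\<close> only the cross term
        survives, with coefficient \<open>2 * c * lead_coeff g\<close>, whereas the power sums force
        this coefficient to be 0.\<close>
      define e where "e = n + 1 + degree g"
      have e: "n + 2 < e" "e \<le> 2 * n" using \<open>\<not> degree g \<le> 1\<close> dg by (auto simp: e_def)
      have f2: "f ^ 2 = smult (c\<^sup>2) (L ^ 2) + (smult c (L * g) + smult c (L * g)) + g ^ 2"
        unfolding fg power2_eq_square distrib_left distrib_right mult_smult_left mult_smult_right
          mult.commute[of g L] smult_add_right smult_smult by (simp only: add.assoc)
      \<comment> \<open>By Frobenius, \<open>L ^ 2 = (X - u) * (X - u) ^ p\<close> has terms only in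
        degrees 0, 1, \<open>p\<close> and \<open>p + 1\<close>.\<close>
      have LL: "coeff (L ^ 2) e = 0"
      proof -
        define p where "p = 2 * n + 1"
        have ch: "prime CHAR('a poly)" "p = CHAR('a poly)"
          using of_nat_card_UNIV[where ?'a = 'a] q pr unfolding p_def semiring_char_poly
          by (metis CHAR_not_1' One_nat_def of_nat_eq_0_iff_char_dvd prime_nat_iff)+
        have "[:- u, 1:] = [:- u:] + monom 1 1" by (simp add: monom_Suc)
        then have "[:- u, 1:] ^ p = [:- u:] ^ p + monom 1 1 ^ p"
          using freshmans_dream[OF ch] by simp
        also have "\<dots> = [:(- u) ^ p:] + monom 1 p"
          by (simp add: poly_const_pow monom_power)
        finally have "[:- u, 1:] ^ p = [:(- u) ^ p:] + monom 1 p" .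
        moreover have "L ^ 2 = [:- u, 1:] * [:- u, 1:] ^ p"
          unfolding L_def p_def power_mult[symmetric] power_Suc[symmetric] by (rule arg_cong) simp
        ultimately have "L ^ 2 = [:- u, 1:] * ([:(- u) ^ p:] + monom 1 p)" by simp
        then show ?thesis using e n by (auto simp: p_def coeff_pCons split: nat.splits)
      qed
      have "coeff (L * g) (degree L + degree g) = lead_coeff g"
        using coeff_mult_degree_sum[of L g] lL by (simp only: dL mult_1_left)
      then have Lg: "coeff (L * g) e = lead_coeff g" by (simp add: e_def dL)
      have "degree (g ^ 2) < e" using dg degree_power_le[of g 2] by (simp add: e_def)
      then have gg: "coeff (g ^ 2) e = 0" by (rule coeff_eq_0)
      have "coeff (f ^ 2) e = 0"
        using e df degree_power_le[of f 2] n by (intro high) auto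
      then have "c * lead_coeff g + c * lead_coeff g = 0"
        unfolding f2 coeff_add coeff_smult LL Lg gg by simp
      then have "lead_coeff g = 0" using c0 two by (simp add: mult_2[symmetric])
      then have "g = 0" by simp
      then show False using \<open>\<not> degree g \<le> 1\<close> by simp
    qed
    then have "g = [:coeff g 0, coeff g 1:]"
      by (intro poly_eq_if_degree_less_2) simp
    then have "smult c L + g = smult c L + [:coeff g 0, coeff g 1:]" by (rule arg_cong)
    with fg have "f = smult c L + [:coeff g 0, coeff g 1:]" by (rule trans)
    with c0 show ?thesis unfolding L_def by blast
  qed
qed

section \<open>Half lines and the classification of cliques over a prime field\<close>

lemma nonsquares_eq:
  fixes m :: "'a::{field,finite}"
  assumes q: "card (UNIV :: 'a set) = 2 * n + 1" and m: "m \<notin> squares"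
  shows "- squares = (\<lambda>s. m * s) ` (squares - {0})"
proof -
  have m0: "m \<noteq> 0" using m by auto
  have mn: "m ^ n = -1"
    using m squares_iff_power(2)[OF q m0] by simp
  have div_m: "x \<notin> squares \<longleftrightarrow> x \<noteq> 0 \<and> x / m \<in> squares" for x
  proof (cases "x = 0")
    case False
    then have "x / m \<in> squares \<longleftrightarrow> - (x ^ n) = 1"
      using squares_iff_power(1)[OF q, of "x / m"] m0 mn by (simp add: power_divide)
    also have "\<dots> \<longleftrightarrow> x ^ n = -1" by (metis minus_minus)
    finally show ?thesis using squares_iff_power(2)[OF q False] False by simp
  qed simp
  show ?thesis
  proof (intro equalityI subsetI)
    fix x :: 'a assume "x \<in> - squares"
    then have "x = m * (x / m)" "x / m \<in> squares - {0}" using div_m[of x] m0 by simp_all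
    then show "x \<in> (\<lambda>s. m * s) ` (squares - {0})" by (rule image_eqI)
  next
    fix x :: 'a assume "x \<in> (\<lambda>s. m * s) ` (squares - {0})"
    then show "x \<in> - squares" using div_m[of x] m0 by auto
  qed
qed

text \<open>The non-squares are \<open>m\<close> times the nonzero squares, and including 0 only
  adds the common end point \<open>g 0 = h 0\<close>.\<close>

lemma image_half_lines:
  fixes m :: "'a::{field,finite}"
  assumes q: "card (UNIV :: 'a set) = 2 * n + 1" and m: "m \<notin> squares" and "g 0 = h 0"
  shows "g ` squares \<union> h ` (- squares) = g ` squares \<union> (\<lambda>s. h (m * s)) ` squares"
proof -
  have "(\<lambda>s. h (m * s)) ` squares = (\<lambda>s. h (m * s)) ` insert 0 (squares - {0})"
    by (simp add: insert_absorb)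
  also have "\<dots> = insert (h 0) (h ` (- squares))"
    unfolding nonsquares_eq[OF q m] image_insert image_image by simp
  finally have "(\<lambda>s. h (m * s)) ` squares = insert (h 0) (h ` (- squares))" .
  moreover have "insert (h 0) (g ` squares) = g ` squares"
    using assms(3) by (metis image_eqI insert_absorb zero_in_squares)
  ultimately show ?thesis by (metis Un_insert_left Un_insert_right)
qed

text \<open>With the common end at the origin, \<open>t ^ n\<close> is 1 on one half line and -1 on
  the other. The vanishing power sums of degree \<open>n\<close> therefore equate the mixed
  monomials of the two directions.\<close>

lemma half_lines_axes:
  fixes S :: "('a::{field,finite} \<times> 'a) set"
  assumes q: "card (UNIV :: 'a set) = 2 * n + 1" and pr: "prime (2 * n + 1)" and n: "3 \<le> n"
    and cS: "card S = card (UNIV :: 'a set)"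
    and clique: "\<And>x y x' y'. (x, y) \<in> S \<Longrightarrow> (x', y') \<in> S \<Longrightarrow> (x - x') * (y - y') \<in> squares"
    and S: "S = (\<lambda>t. (x0 + x1 * t, y0 + y1 * t)) ` squares \<union> (\<lambda>t. (x0 + x2 * t, y0 + y2 * t)) ` (- squares)"
    and det: "x1 * y2 \<noteq> x2 * y1"
  shows "x1 * y1 = 0 \<and> x2 * y2 = 0"
proof -
  define h where "h t = (if t \<in> squares then (x1 * t, y1 * t) else (x2 * t, y2 * t))" for t
  define S' where "S' = (\<lambda>(x, y). (x - x0, y - y0)) ` S"
  have S': "S' = range h"
    unfolding S'_def S image_Un image_image h_def by (auto simp: image_iff)
  have cS': "card S' = card (UNIV :: 'a set)"
    unfolding S'_def cS[symmetric] by (rule card_image) (auto simp: inj_on_def)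
  then have inj: "inj h" unfolding S' by (intro eq_card_imp_inj_on) auto
  have key: "x1 ^ i * y1 ^ j = x2 ^ i * y2 ^ j" if ij: "i + j = n" "0 < i" "0 < j" for i j
  proof -
    have "(\<Sum>(x, y)\<in>S'. x ^ i * y ^ j) = 0"
      using ij clique by (intro clique_power_sums[OF q pr cS']) (auto simp: S'_def)
    moreover have "(\<Sum>(x, y)\<in>S'. x ^ i * y ^ j) = (\<Sum>t\<in>UNIV. case h t of (x, y) \<Rightarrow> x ^ i * y ^ j)"
      unfolding S' by (subst sum.reindex[OF inj]) simp
    moreover have "\<dots> = (\<Sum>t\<in>(UNIV :: 'a set). (if t = 0 then 0 else 1) *
        (if t \<in> squares then x1 ^ i * y1 ^ j else - (x2 ^ i * y2 ^ j)))"
    proof (intro sum.cong refl)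
      fix t :: 'a
      have *: "(a * t) ^ i * (b * t) ^ j = t ^ n * (a ^ i * b ^ j)" for a b
        by (simp add: ij(1)[symmetric] power_add power_mult_distrib)
      show "(case h t of (x, y) \<Rightarrow> x ^ i * y ^ j) = (if t = 0 then 0 else 1) *
        (if t \<in> squares then x1 ^ i * y1 ^ j else - (x2 ^ i * y2 ^ j))"
      proof (cases "t = 0")
        case True
        then show ?thesis using ij(2) by (simp add: h_def)
      next
        case False
        show ?thesis
          using squares_iff_power(1,2)[OF q False] False by (cases "t \<in> squares") (simp_all add: h_def *)
      qed
    qed
    moreover have "\<dots> = (\<Sum>t\<in>squares - {0 :: 'a}. x1 ^ i * y1 ^ j) + (\<Sum>t\<in>(- squares :: 'a set). - (x2 ^ i * y2 ^ j))"
    proof -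
      let ?F = "\<lambda>t::'a. (if t = 0 then 0 else 1) *
        (if t \<in> squares then x1 ^ i * y1 ^ j else - (x2 ^ i * y2 ^ j))"
      have "sum ?F UNIV = sum ?F squares + sum ?F (- squares)"
        using sum.union_disjoint[of squares "- squares" ?F] by (simp add: Compl_partition)
      moreover have "sum ?F squares = sum ?F (squares - {0})"
        by (rule sum.mono_neutral_right) auto
      moreover have "sum ?F (squares - {0}) = (\<Sum>t\<in>squares - {0 :: 'a}. x1 ^ i * y1 ^ j)"
        by (rule sum.cong) auto
      moreover have "sum ?F (- squares) = (\<Sum>t\<in>(- squares :: 'a set). - (x2 ^ i * y2 ^ j))"
        by (rule sum.cong) auto
      ultimately show ?thesis by (simp only:)
    qed
    moreover note squares_eq_roots_of_unity(2,3)[OF q]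
    moreover have "(of_nat n :: 'a) \<noteq> 0"
      using of_nat_neq_0_below_prime_card[where ?'a = 'a] pr q n by simp
    ultimately show ?thesis by (simp add: algebra_simps)
  qed
  \<comment> \<open>Two neighbouring monomials, with the same values for both directions:
    \<open>A * x = B * y\<close> holds for two independent vectors \<open>(x, y)\<close>, so
    \<open>A = 0\<close>.\<close>
  define A where "A = x1 * y1 ^ (n - 1)"
  define B where "B = x1 ^ 2 * y1 ^ (n - 2)"
  have A: "A = x2 * y2 ^ (n - 1)" and B: "B = x2 ^ 2 * y2 ^ (n - 2)"
    using key[of 1 "n - 1"] key[of 2 "n - 2"] n by (auto simp: A_def B_def)
  have "n - 1 = Suc (n - 2)" using n by simp
  then have pw: "y ^ (n - 1) = y * y ^ (n - 2)" for y :: 'a by (simp only: power_Suc)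
  have "B * y1 = A * x1" unfolding A_def B_def pw by (simp add: power2_eq_square)
  moreover have "B * y2 = A * x2" unfolding A B pw by (simp add: power2_eq_square)
  ultimately have "A * x1 * y2 = A * x2 * y1" by (metis mult.assoc mult.commute)
  then have "A = 0" using det by simp
  have "x1 * y1 ^ (n - 1) = 0" using \<open>A = 0\<close> by (simp only: A_def)
  moreover have "x2 * y2 ^ (n - 1) = 0" using \<open>A = 0\<close> by (simp only: A)
  ultimately show ?thesis by auto
qed

text \<open>Of the possible shapes of \<open>f\<close>, degree at most 1 gives a line, degree 2
  contradicts a second projection, and degree \<open>n + 1\<close> gives two half lines. The bound
  13 supplies \<open>n \<ge> 6\<close>.\<close>

theorem prime_field_clique:
  fixes S :: "('a::{field,finite} \<times> 'a) set"
  assumes pr: "prime (card (UNIV :: 'a set))" and large: "card (UNIV :: 'a set) \<ge> 13"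
    and cS: "card S = card (UNIV :: 'a set)"
    and clique: "\<And>x y x' y'. (x, y) \<in> S \<Longrightarrow> (x', y') \<in> S \<Longrightarrow> (x - x') * (y - y') \<in> squares"
  shows "(\<exists>x0 y0 x1 y1. (x1, y1) \<noteq> (0, 0) \<and> S = range (\<lambda>t. (x0 + x1 * t, y0 + y1 * t))) \<or>
    (\<exists>x0 y0 x1 y1. x1 \<noteq> 0 \<and> y1 \<noteq> 0 \<and>
      S = (\<lambda>s. (x0 + x1 * s, y0)) ` squares \<union> (\<lambda>s. (x0, y0 + y1 * s)) ` squares)"
proof -
  define n where "n = card (UNIV :: 'a set) div 2"
  have "odd (card (UNIV :: 'a set))" using pr large by (intro prime_odd_nat) auto
  then have q: "card (UNIV :: 'a set) = 2 * n + 1" by (simp add: n_def)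
  then have n: "n \<ge> 6" and pr': "prime (2 * n + 1)" using large pr by auto
  have cN: "card (- squares :: 'a set) = n" using squares_eq_roots_of_unity(3)[OF q] by simp
  then have "\<not> card (- squares :: 'a set) \<le> Suc 0" using n by simp
  then obtain m m' :: 'a where m: "m \<notin> squares" "m' \<notin> squares" "m' \<noteq> m"
    by (auto simp: card_le_Suc0_iff_eq)
  have bij: "bij_betw (\<lambda>(x, y). y - m * x) S UNIV" if "m \<notin> squares" for m
    using slope_bij[OF cS _ that] clique by blast
  define g where "g u = fst (inv_into S (\<lambda>(x, y). y - m * x) u)" for u
  obtain f where f: "degree f \<le> 2 * n" "\<And>u. poly f u = g u"
    using finite_field_interpolation[of g] q by auto
  have fS: "poly f (y - m * x) = x" if "(x, y) \<in> S" for x y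
    using bij_betw_inv_into_left[OF bij[OF m(1)] that] by (simp add: f g_def)
  have S: "S = range (\<lambda>u. (poly f u, u + m * poly f u))"
  proof (intro equalityI subsetI)
    fix p assume "p \<in> S"
    then show "p \<in> range (\<lambda>u. (poly f u, u + m * poly f u))"
      by (cases p) (auto simp: image_iff fS intro!: exI[of _ "snd p - m * fst p"])
  next
    fix p assume "p \<in> range (\<lambda>u. (poly f u, u + m * poly f u))"
    then obtain u where u: "p = (poly f u, u + m * poly f u)" by blast
    obtain x y where "(x, y) \<in> S" "u = y - m * x"
      using bij_betw_imp_surj_on[OF bij[OF m(1)]] by (metis (no_types, lifting) UNIV_I case_prod_conv imageE surj_pair)
    then show "p \<in> S" using u fS by simp
  qed
  \<comment> \<open>Substituting \<open>u = y - m * x\<close> expands the sum into mixed power sums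
    of \<open>S\<close> of degree \<open>l + k\<close>.\<close>
  have sums: "(\<Sum>u\<in>UNIV. u ^ l * poly f u ^ k) = 0" if lk: "l + k < n" for l k
  proof -
    have "(\<Sum>u\<in>UNIV. u ^ l * poly f u ^ k) = (\<Sum>(x, y)\<in>S. (y - m * x) ^ l * x ^ k)"
      using sum.reindex_bij_betw[OF bij[OF m(1)], of "\<lambda>u. u ^ l * poly f u ^ k"] fS
      by (auto simp: split_beta intro!: sum.cong)
    also have "\<dots> = (\<Sum>(x, y)\<in>S. \<Sum>i\<le>l. of_nat (l choose i) * (- m) ^ i * (x ^ (i + k) * y ^ (l - i)))"
    proof (intro sum.cong refl, clarify)
      fix x y
      have "(y - m * x) ^ l = (\<Sum>i\<le>l. of_nat (l choose i) * (- m * x) ^ i * y ^ (l - i))"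
        unfolding binomial_ring[symmetric] by simp
      then have "(y - m * x) ^ l * x ^ k =
          (\<Sum>i\<le>l. of_nat (l choose i) * (- m * x) ^ i * y ^ (l - i) * x ^ k)"
        by (simp only: sum_distrib_right)
      also have "\<dots> = (\<Sum>i\<le>l. of_nat (l choose i) * (- m) ^ i * (x ^ (i + k) * y ^ (l - i)))"
        unfolding power_mult_distrib power_add by (simp only: mult_ac)
      finally show "(y - m * x) ^ l * x ^ k =
          (\<Sum>i\<le>l. of_nat (l choose i) * (- m) ^ i * (x ^ (i + k) * y ^ (l - i)))" .
    qed
    also have "\<dots> = (\<Sum>i\<le>l. of_nat (l choose i) * (- m) ^ i * (\<Sum>(x, y)\<in>S. x ^ (i + k) * y ^ (l - i)))"
      unfolding split_beta sum_distrib_left by (rule sum.swap)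
    also have "\<dots> = 0"
      using clique_power_sums[OF q pr' cS] clique lk by (intro sum.neutral) auto
    finally show ?thesis .
  qed
  have two: "(2::'a) \<noteq> 0"
    using of_nat_neq_0_below_prime_card[where ?'a = 'a, of 2] pr large by auto
  consider "degree f \<le> 1" | "degree f = 2" |
    c u a b where "c \<noteq> 0" "f = smult c ([:- u, 1:] ^ (n + 1)) + [:b, a:]"
    using low_power_sums_imp_poly_form[OF q pr' n f(1) sums] by force
  then show ?thesis
  proof cases
    case 1
    then have "f = [:coeff f 0, coeff f 1:]" by (intro poly_eq_if_degree_less_2) simp
    then have pf: "poly f u = coeff f 0 + coeff f 1 * u" for u
      by (metis add.right_neutral mult.commute mult_zero_right poly_0 poly_pCons)
    have "S = range (\<lambda>t. (coeff f 0 + coeff f 1 * t, m * coeff f 0 + (1 + m * coeff f 1) * t))"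
      unfolding S pf by (simp add: algebra_simps)
    moreover have "(coeff f 1, 1 + m * coeff f 1) \<noteq> (0, 0)" by auto
    ultimately show ?thesis by blast
  next
    case 2
    \<comment> \<open>Projecting along the second non-square \<open>m'\<close> gives
      \<open>u + (m - m') * poly f u\<close>, a quadratic with coefficients \<open>d\<close> and
      \<open>e\<close> in degrees 2 and 1. It takes equal values at \<open>u\<close> and
      \<open>v\<close> whenever \<open>u + v = - e / d\<close>.\<close>
    define d where "d = (m - m') * coeff f 2"
    define e where "e = (m - m') * coeff f 1 + 1"
    have "coeff f 2 \<noteq> 0" using 2 by (metis leading_coeff_0_iff degree_0 zero_neq_numeral)
    then have d0: "d \<noteq> 0" using m(3) by (simp add: d_def)
    have pf: "poly f u = coeff f 0 + coeff f 1 * u + coeff f 2 * u ^ 2" for u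
      unfolding poly_altdef 2 by (simp add: numeral_2_eq_2)
    obtain u v where uv: "u + v = - e / d" "u \<noteq> v"
    proof (cases "e = 0")
      case True
      have "(1::'a) \<noteq> -1" using two by (metis one_add_one add.right_inverse)
      then show ?thesis using that[of 1 "-1"] True by simp
    next
      case False
      then show ?thesis using that[of 0 "- e / d"] d0 by simp
    qed
    have "u + (m - m') * poly f u = v + (m - m') * poly f v"
    proof -
      have "(u - v) * (d * (u + v) + e) = 0" using uv d0 by simp
      then show ?thesis unfolding pf d_def e_def by (simp add: algebra_simps power2_eq_square)
    qed
    moreover have "inj_on (\<lambda>(x, y). y - m' * x) S" using bij[OF m(2)] by (simp add: bij_betw_def)
    moreover have "(poly f w, w + m * poly f w) \<in> S" for w by (subst S) blast
    ultimately have "(poly f u, u + m * poly f u) = (poly f v, v + m * poly f v)"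
      by (elim inj_onD) (simp_all add: algebra_simps)
    then have "u = v" by auto
    with \<open>u \<noteq> v\<close> show ?thesis ..
  next
    case 3
    \<comment> \<open>The common end is the point with parameter \<open>u\<close>. As
      \<open>t ^ (n + 1)\<close> is \<open>t\<close> or \<open>- t\<close>, the polynomial is affine
      on each half, with slope \<open>a + c\<close> or \<open>a - c\<close>.\<close>
    define x0 y0 where "x0 = b + a * u" and "y0 = u + m * (b + a * u)"
    define x1 y1 where "x1 = a + c" and "y1 = 1 + m * (a + c)"
    define x2 y2 where "x2 = a - c" and "y2 = 1 + m * (a - c)"
    have pt: "(poly f (u + t), (u + t) + m * poly f (u + t)) =
        (if t \<in> squares then (x0 + x1 * t, y0 + y1 * t) else (x0 + x2 * t, y0 + y2 * t))" for t
    proof -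
      have "t ^ (n + 1) = (if t \<in> squares then t else - t)"
        using squares_iff_power(1,2)[OF q, of t] by (cases "t = 0") auto
      moreover have "poly f (u + t) = c * t ^ (n + 1) + (b + a * (u + t))"
        unfolding 3(2) by (simp add: algebra_simps)
      ultimately have pf: "poly f (u + t) = c * (if t \<in> squares then t else - t) + (b + a * (u + t))"
        by (simp only:)
      show ?thesis unfolding pf x0_def y0_def x1_def y1_def x2_def y2_def
        by (cases "t \<in> squares") (simp_all add: algebra_simps)
    qed
    have "S = (\<lambda>u. (poly f u, u + m * poly f u)) ` range ((+) u)" unfolding S by simp
    then have "S = range (\<lambda>t. (poly f (u + t), (u + t) + m * poly f (u + t)))"
      unfolding image_image .
    then have S: "S = (\<lambda>t. (x0 + x1 * t, y0 + y1 * t)) ` squares \<union> (\<lambda>t. (x0 + x2 * t, y0 + y2 * t)) ` (- squares)"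
      unfolding pt by (auto simp: image_iff)
    \<comment> \<open>The determinant is \<open>2 * c\<close>.\<close>
    have det: "x1 * y2 \<noteq> x2 * y1"
    proof
      assume "x1 * y2 = x2 * y1"
      then have "c + c = 0" by (simp add: x1_def y1_def x2_def y2_def algebra_simps)
      then show False using 3(1) two by (simp add: mult_2[symmetric])
    qed
    have ax: "x1 * y1 = 0" "x2 * y2 = 0"
      using half_lines_axes[OF q pr' _ cS _ S det] clique n by auto
    have S2: "S = (\<lambda>t. (x0 + x1 * t, y0 + y1 * t)) ` squares \<union> (\<lambda>s. (x0 + x2 * (m * s), y0 + y2 * (m * s))) ` squares"
      unfolding S by (rule image_half_lines[OF q m(1)]) simp
    have m0: "m \<noteq> 0" using m(1) by auto
    show ?thesis
    proof (cases "x1 = 0")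
      case True
      then have "y1 \<noteq> 0" "x2 \<noteq> 0" "y2 = 0" using ax det by auto
      then have "S = (\<lambda>s. (x0 + (x2 * m) * s, y0)) ` squares \<union> (\<lambda>s. (x0, y0 + y1 * s)) ` squares"
        unfolding S2 using True by (auto simp: mult.assoc)
      moreover have "x2 * m \<noteq> 0" using \<open>x2 \<noteq> 0\<close> m0 by simp
      ultimately show ?thesis using \<open>y1 \<noteq> 0\<close> by blast
    next
      case False
      then have "y1 = 0" "y2 \<noteq> 0" "x2 = 0" using ax det by auto
      then have "S = (\<lambda>s. (x0 + x1 * s, y0)) ` squares \<union> (\<lambda>s. (x0, y0 + (y2 * m) * s)) ` squares"
        unfolding S2 by (auto simp: mult.assoc)
      moreover have "y2 * m \<noteq> 0" using \<open>y2 \<noteq> 0\<close> m0 by simp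
      ultimately show ?thesis using False by blast
    qed
  qed
qed

section \<open>Norm and automorphisms of \<open>F[i]\<close>\<close>

lemma gauss_re_add [simp]: "gauss_re (u + v) = gauss_re u + gauss_re v"
  and gauss_im_add [simp]: "gauss_im (u + v) = gauss_im u + gauss_im v"
  by (transfer, simp add: poly_mod_add_left)+

lemma gauss_re_diff [simp]: "gauss_re (u - v) = gauss_re u - gauss_re v"
  and gauss_im_diff [simp]: "gauss_im (u - v) = gauss_im u - gauss_im v"
  by (transfer, simp add: poly_mod_diff_left)+

lemma gauss_of_0 [simp]: "gauss_of 0 = 0"
  and gauss_of_1 [simp]: "gauss_of 1 = 1"
  and gauss_of_add: "gauss_of (a + b) = gauss_of a + gauss_of b"
  and gauss_of_diff: "gauss_of (a - b) = gauss_of a - gauss_of b"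
  and gauss_of_mult: "gauss_of (a * b) = gauss_of a * gauss_of b"
  by (transfer, simp add: gauss_rel_def one_pCons)+

lemma gauss_re_of [simp]: "gauss_re (gauss_of a) = a"
  and gauss_im_of [simp]: "gauss_im (gauss_of a) = 0"
  and gauss_re_i [simp]: "gauss_re gauss_i = 0"
  and gauss_im_i [simp]: "gauss_im gauss_i = 1"
  using gauss_re_Gauss[of a 0] gauss_im_Gauss[of a 0] gauss_re_Gauss[of 0 1] gauss_im_Gauss[of 0 1]
  by simp_all

lemma gauss_re_im_0_1 [simp]: "gauss_re 0 = 0" "gauss_im 0 = 0" "gauss_re 1 = 1" "gauss_im 1 = 0"
  using gauss_re_of[of 0] gauss_im_of[of 0] gauss_re_of[of 1] gauss_im_of[of 1] by simp_all

lemma gauss_eqI: "gauss_re u = gauss_re v \<Longrightarrow> gauss_im u = gauss_im v \<Longrightarrow> u = v"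
  by (metis gauss_eq)

lemma gauss_re_mult [simp]: "gauss_re (u * v) = gauss_re u * gauss_re v - gauss_im u * gauss_im v"
  and gauss_im_mult [simp]: "gauss_im (u * v) = gauss_re u * gauss_im v + gauss_im u * gauss_re v"
proof -
  have i2: "gauss_i * (gauss_i * z) = - z" for z :: "'a gauss"
    using gauss_i_squared[where ?'a = 'a] by (simp add: power2_eq_square mult.assoc[symmetric])
  have "u * v = (gauss_of (gauss_re u) + gauss_of (gauss_im u) * gauss_i) *
      (gauss_of (gauss_re v) + gauss_of (gauss_im v) * gauss_i)"
    using gauss_eq[of u] gauss_eq[of v] by simp
  also have "\<dots> = gauss_of (gauss_re u * gauss_re v - gauss_im u * gauss_im v) +
      gauss_of (gauss_re u * gauss_im v + gauss_im u * gauss_re v) * gauss_i"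
    by (simp add: gauss_of_add gauss_of_diff gauss_of_mult algebra_simps i2)
  finally have uv: "u * v = \<dots>" .
  show "gauss_re (u * v) = gauss_re u * gauss_re v - gauss_im u * gauss_im v"
    and "gauss_im (u * v) = gauss_re u * gauss_im v + gauss_im u * gauss_re v"
    unfolding uv by (rule gauss_re_Gauss, rule gauss_im_Gauss)
qed

definition gnorm :: "'a::field gauss \<Rightarrow> 'a" where
  "gnorm z = gauss_re z ^ 2 + gauss_im z ^ 2"

lemma sqdist_eq_gnorm: "sqdist u v = gnorm (u - v)"
  by (simp add: sqdist_def gnorm_def)

lemma gnorm_mult: "gnorm (u * v) = gnorm u * gnorm v"
  by (simp add: gnorm_def power2_eq_square algebra_simps)

text \<open>The witness is the conjugate divided by the norm. The ring may have zero divisors, so a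
  nonzero norm takes the place of \<open>w \<noteq> 0\<close>.\<close>

lemma gauss_inverse:
  assumes "gnorm w \<noteq> 0"
  obtains w' where "w * w' = 1" "gnorm w' = 1 / gnorm w"
proof
  let ?w = "gauss_of (gauss_re w / gnorm w) - gauss_of (gauss_im w / gnorm w) * gauss_i"
  show *: "w * ?w = 1"
    using assms
    by (intro gauss_eqI) (simp_all add: add_divide_distrib[symmetric] gnorm_def power2_eq_square)
  have "gnorm w * gnorm ?w = 1"
    unfolding gnorm_mult[symmetric] * by (simp add: gnorm_def)
  then show "gnorm ?w = 1 / gnorm w" using assms by (simp add: field_simps)
qed

definition gconj :: "'a::field gauss \<Rightarrow> 'a gauss" where
  "gconj z = gauss_of (gauss_re z) - gauss_of (gauss_im z) * gauss_i"

lemma gauss_re_conj [simp]: "gauss_re (gconj z) = gauss_re z"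
  and gauss_im_conj [simp]: "gauss_im (gconj z) = - gauss_im z"
  by (simp_all add: gconj_def)

text \<open>A similarity whose factor is a nonzero square preserves integrality of distances.
  \<open>L\<close> names the direction of the image line, which covers multiplication and
  conjugation alike.\<close>

lemma int_automorphismI:
  fixes \<phi> :: "'a::field gauss \<Rightarrow> 'a gauss"
  assumes "bij \<phi>" and c: "c \<in> squares" "c \<noteq> 0" "\<And>u v. sqdist (\<phi> u) (\<phi> v) = c * sqdist u v"
    and line: "\<And>u w t. \<phi> (u + gauss_of t * w) = \<phi> u + gauss_of t * L w"
  shows "int_automorphism \<phi>"
  unfolding int_automorphism_def
proof (intro conjI allI)
  show "int_dist (\<phi> u) (\<phi> v) = int_dist u v" for u v
    using mult_in_squares_iff[OF c(1,2)] by (simp add: int_dist_def c(3))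
  show "\<exists>u' w'. \<phi> ` gauss_line u w = gauss_line u' w'" for u w
    by (rule exI[of _ "\<phi> u"], rule exI[of _ "L w"]) (simp add: gauss_line_def full_SetCompr_eq image_image line)
qed fact

lemma int_automorphism_mult:
  assumes "gnorm w \<in> squares" "gnorm w \<noteq> 0"
  shows "int_automorphism (\<lambda>z. w * (z - p))"
proof -
  obtain w' where w': "w * w' = 1" using gauss_inverse[OF assms(2)] by blast
  then have w'': "w' * w = 1" by (simp add: mult.commute)
  show ?thesis
  proof (rule int_automorphismI[OF _ assms, where L = "\<lambda>v. w * v"])
    show "bij (\<lambda>z. w * (z - p))"
      by (rule bij_betw_byWitness[where f' = "\<lambda>z. w' * z + p"])
        (simp_all add: mult.assoc[symmetric] w' w'')
    show "sqdist (w * (u - p)) (w * (v - p)) = gnorm w * sqdist u v" for u v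
      by (simp add: sqdist_eq_gnorm gnorm_mult[symmetric] right_diff_distrib)
  qed (simp add: algebra_simps)
qed

text \<open>Serves to exchange the two isotropic directions \<open>1 + \<omega> i\<close> and
  \<open>1 - \<omega> i\<close>.\<close>

lemma int_automorphism_conj: "int_automorphism (\<lambda>z. gconj (z - p))"
proof (rule int_automorphismI[where c = 1 and L = gconj])
  show "bij (\<lambda>z. gconj (z - p))"
    by (rule bij_betw_byWitness[where f' = "\<lambda>z. gconj z + p"]) (auto intro: gauss_eqI)
  show "1 \<in> squares" unfolding squares_def by (metis (mono_tags, lifting) mem_Collect_eq one_power2)
qed (auto simp: sqdist_def power2_commute power2_eq_square algebra_simps intro!: gauss_eqI)

text \<open>The inverse of \<open>w\<close> again has square norm, and multiplication by it turns
  the direction into 1.\<close>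

lemma integral_line_isomorphic:
  assumes P: "P = range (\<lambda>t. p + gauss_of t * w)" and w: "gnorm w \<in> squares" "gnorm w \<noteq> 0"
  shows "isomorphic_point_sets P {gauss_of t | t. True}"
proof -
  obtain w' where w': "w * w' = 1" "gnorm w' = 1 / gnorm w" using gauss_inverse[OF w(2)] by blast
  have "gnorm w' \<in> squares"
    using mult_in_squares_iff[OF w, of "gnorm w'"] w w' by (simp add: squares_def) (metis one_power2)
  then have "int_automorphism (\<lambda>z. w' * (z - p))"
    using w w' by (intro int_automorphism_mult) auto
  moreover have "w' * (p + gauss_of t * w - p) = gauss_of t * (w * w')" for t
    by (simp add: mult_ac)
  then have "(\<lambda>z. w' * (z - p)) ` P = {gauss_of t | t. True}"
    unfolding P image_image by (simp add: full_SetCompr_eq w'(1))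
  ultimately show ?thesis unfolding isomorphic_point_sets_def by blast
qed

section \<open>Classification in the two residue classes of \<open>q\<close> modulo 4\<close>

lemma card_gauss:
  "finite (UNIV :: 'a::{field,finite} gauss set)"
  "card (UNIV :: 'a gauss set) = card (UNIV :: 'a set) ^ 2"
proof -
  have "bij_betw (\<lambda>z. (gauss_re z, gauss_im z)) UNIV (UNIV :: ('a \<times> 'a) set)"
    by (rule bij_betw_byWitness[where f' = "\<lambda>(a, b). gauss_of a + gauss_of b * gauss_i"])
      (auto simp: gauss_eq[symmetric])
  from bij_betw_finite[OF this] bij_betw_same_card[OF this]
  show "finite (UNIV :: 'a gauss set)" "card (UNIV :: 'a gauss set) = card (UNIV :: 'a set) ^ 2"
    by (simp_all add: card_cartesian_product power2_eq_square flip: UNIV_Times_UNIV)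
qed

text \<open>\<open>gauss\<close> carries only a ring structure, so the clique theorem is applied to
  the image of \<open>P\<close> under an embedding \<open>\<epsilon>\<close> into the algebraic
  closure of \<open>'a\<close>.\<close>

theorem integral_point_set_3_mod_4:
  fixes P :: "'a::{field,finite} gauss set"
  assumes q: "card (UNIV :: 'a set) = q" "q mod 4 = 3" "prime CHAR('a)" "q = CHAR('a) ^ r"
    and P: "integral_point_set P" "card P = q"
  shows "isomorphic_point_sets P {gauss_of t | t. True}"
proof -
  obtain k where k: "q = 4 * k + 3" using q(2) by (metis mult_div_mod_eq)
  define n where "n = 2 * k + 1"
  have n: "card (UNIV :: 'a set) = 2 * n + 1" "odd n" "q = 2 * n + 1" using q k by (simp_all add: n_def)
  have m1: "(-1::'a) \<notin> squares"
    using squares_iff_power(2)[OF n(1), of "-1"] n(2) by simp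
  have gnorm_0: "z = 0" if "gnorm z = 0" for z :: "'a gauss"
  proof -
    have "gauss_im z = 0"
    proof (rule ccontr)
      assume im: "gauss_im z \<noteq> 0"
      have "-1 = (gauss_re z / gauss_im z) ^ 2"
        using that im by (simp add: gnorm_def field_simps add_eq_0_iff)
      then show False using m1 unfolding squares_def by blast
    qed
    then show ?thesis using that by (intro gauss_eqI) (auto simp: gnorm_def)
  qed
  obtain \<iota> :: "'a alg_closure" where \<iota>2: "\<iota> ^ 2 = -1" using nth_root_exists[of 2] by auto
  then have \<iota>: "\<iota> * \<iota> = -1" by (simp add: power2_eq_square)
  define \<epsilon> where "\<epsilon> z = to_ac (gauss_re z) + to_ac (gauss_im z) * \<iota>" for z :: "'a gauss"
  have \<epsilon>_diff: "\<epsilon> (u - v) = \<epsilon> u - \<epsilon> v" for u v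
    by (simp add: \<epsilon>_def algebra_simps)
  have \<epsilon>_mult: "\<epsilon> (u * v) = \<epsilon> u * \<epsilon> v" for u v
  proof -
    have i2: "\<iota> * (\<iota> * z) = - z" for z by (simp add: \<iota> mult.assoc[symmetric])
    show ?thesis by (simp add: \<epsilon>_def algebra_simps i2)
  qed
  have \<epsilon>_of: "\<epsilon> (gauss_of t) = to_ac t" for t by (simp add: \<epsilon>_def)
  have char: "prime CHAR('a alg_closure)" "q = CHAR('a alg_closure) ^ r" using q by simp_all
  have to_ac_q: "to_ac a ^ q = to_ac a" for a :: 'a
  proof (cases "a = 0")
    case False
    have "q = Suc (card (UNIV :: 'a set) - 1)" using q(1) k by simp
    then have "a ^ q = a * a ^ (card (UNIV :: 'a set) - 1)" by (simp only: power_Suc)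
    then show ?thesis using power_card_UNIV_minus_1[OF False] by (simp flip: to_ac_power)
  qed (use k in simp)
  \<comment> \<open>Here \<open>q mod 4 = 3\<close> enters: Frobenius acts as conjugation, so
    \<open>\<epsilon> z ^ (q + 1)\<close> is the norm.\<close>
  have \<iota>q: "\<iota> ^ q = - \<iota>"
  proof -
    have "q = 2 * (2 * k + 1) + 1" by (simp add: k)
    then have "\<iota> ^ q = (\<iota> ^ 2) ^ (2 * k + 1) * \<iota>"
      by (simp only: power_add[of \<iota>] power_mult power_one_right)
    then show ?thesis by (simp add: \<iota>2)
  qed
  have \<epsilon>_q: "\<epsilon> z ^ q = \<epsilon> (gconj z)" for z
    unfolding \<epsilon>_def freshmans_dream'[OF char] power_mult_distrib to_ac_q \<iota>q by simp
  have "gconj (gconj z) = z" for z :: "'a gauss" by (rule gauss_eqI) simp_all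
  then have \<epsilon>_q2: "\<epsilon> z ^ q\<^sup>2 = \<epsilon> z" for z
    by (simp add: power2_eq_square power_mult \<epsilon>_q)
  have "z * gconj z = gauss_of (gnorm z)" for z :: "'a gauss"
    by (rule gauss_eqI) (simp_all add: gnorm_def power2_eq_square)
  then have norm: "\<epsilon> z ^ (q + 1) = to_ac (gnorm z)" for z
    by (simp add: \<epsilon>_q \<epsilon>_mult[symmetric] \<epsilon>_of)
  have \<epsilon>_0: "z = 0" if "\<epsilon> z = 0" for z
    using norm[of z] that by (intro gnorm_0) simp
  have inj: "inj \<epsilon>"
    by (rule injI) (metis \<epsilon>_0 \<epsilon>_diff eq_iff_diff_eq_0)
  have fixed: "card {z::'a alg_closure. z ^ Q = z} \<le> Q" "finite {z::'a alg_closure. z ^ Q = z}"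
    if "Q > 1" for Q
  proof -
    let ?R = "insert 0 {z::'a alg_closure. z ^ (Q - 1) = 1}"
    have sub: "{z::'a alg_closure. z ^ Q = z} \<subseteq> ?R"
    proof
      fix z :: "'a alg_closure" assume "z \<in> {z. z ^ Q = z}"
      moreover have "Q = Suc (Q - 1)" using that by simp
      then have "z ^ Q = z * z ^ (Q - 1)" by (metis power_Suc)
      ultimately show "z \<in> ?R" by simp
    qed
    have f: "finite ?R" using that card_power_eq_le(1)[of "Q - 1" "1::'a alg_closure"] by simp
    have "card ?R \<le> Suc (card {z::'a alg_closure. z ^ (Q - 1) = 1})"
      using f by (simp add: card_insert_if)
    also have "\<dots> \<le> Q"
      using card_power_eq_le(2)[of "Q - 1" "1::'a alg_closure"] that by simp
    finally show "card {z::'a alg_closure. z ^ Q = z} \<le> Q"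
      using card_mono[OF f sub] by simp
    show "finite {z::'a alg_closure. z ^ Q = z}" by (rule finite_subset[OF sub f])
  qed
  have "q > 1" "odd q" using k by simp_all
  then have "q\<^sup>2 > 1" by (simp add: one_less_power del: One_nat_def)
  have K: "card {z::'a alg_closure. z ^ q\<^sup>2 = z} = q\<^sup>2"
  proof (rule antisym)
    have "card (range \<epsilon>) \<le> card {z::'a alg_closure. z ^ q\<^sup>2 = z}"
      using \<epsilon>_q2 by (intro card_mono fixed(2)[OF \<open>q\<^sup>2 > 1\<close>]) auto
    then show "q\<^sup>2 \<le> card {z::'a alg_closure. z ^ q\<^sup>2 = z}"
      using card_gauss(2)[where ?'a = 'a] q(1) by (simp add: card_image[OF inj])
  qed (rule fixed(1)[OF \<open>q\<^sup>2 > 1\<close>])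
  have range_ac: "range to_ac = {z::'a alg_closure. z ^ q = z}"
    using to_ac_q fixed[OF \<open>q > 1\<close>] q(1) by (intro card_seteq) (auto simp: card_image[OF inj_to_ac])
  \<comment> \<open>The exponent factors as \<open>(q + 1) * n\<close>: the first factor produces
    the norm, the second is Euler's criterion for it.\<close>
  have sq: "\<epsilon> (u - v) ^ ((q\<^sup>2 - 1) div 2) = 1" and nz: "gnorm (u - v) \<noteq> 0" "gnorm (u - v) \<in> squares"
    if "u \<in> P" "v \<in> P" "u \<noteq> v" for u v
  proof -
    show s: "gnorm (u - v) \<in> squares"
      using P(1) that unfolding integral_point_set_def int_dist_def sqdist_eq_gnorm
      by (metis zero_neq_one)
    show n0: "gnorm (u - v) \<noteq> 0" using gnorm_0[of "u - v"] that by auto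
    have "(q\<^sup>2 - 1) div 2 = (q + 1) * n"
      by (simp add: n(3) power2_eq_square algebra_simps)
    then have "\<epsilon> (u - v) ^ ((q\<^sup>2 - 1) div 2) = to_ac (gnorm (u - v) ^ n)"
      by (simp only: power_mult norm to_ac_power)
    moreover have "gnorm (u - v) ^ n = 1" using squares_iff_power(1)[OF n(1) n0] s by simp
    ultimately show "\<epsilon> (u - v) ^ ((q\<^sup>2 - 1) div 2) = 1" by (simp only: to_ac_1)
  qed
  have finP: "finite P" by (rule finite_subset[OF subset_UNIV card_gauss(1)])
  have "\<not> card P \<le> Suc 0" using P(2) \<open>q > 1\<close> by simp
  then obtain p p' where p: "p \<in> P" "p' \<in> P" "p' \<noteq> p"
    by (auto simp: card_le_Suc0_iff_eq[OF finP])
  define d where "d = \<epsilon> (p' - p)"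
  have d0: "d \<noteq> 0" using \<epsilon>_0[of "p' - p"] p by (auto simp: d_def)
  \<comment> \<open>Normalised so that \<open>p\<close> and \<open>p'\<close> become 0 and 1.
    Dividing by \<open>d\<close> keeps differences square, since \<open>d\<close> comes from a
    difference of \<open>P\<close>.\<close>
  define S where "S = (\<lambda>u. \<epsilon> (u - p) / d) ` P"
  have "S \<subseteq> {z. z ^ q = z}"
  proof (rule square_clique_eq_subfield[OF char \<open>odd q\<close> \<open>q > 1\<close> K])
    have dq: "d ^ q\<^sup>2 = d" unfolding d_def by (rule \<epsilon>_q2)
    show "x ^ q\<^sup>2 = x" if "x \<in> S" for x
      using that by (auto simp: S_def power_divide dq \<epsilon>_q2)
    have "inj_on (\<lambda>u. \<epsilon> (u - p) / d) P"
      using d0 by (auto simp: inj_on_def \<epsilon>_diff injD[OF inj])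
    then show "card S = q" unfolding S_def P(2)[symmetric] by (rule card_image)
    show "0 \<in> S" "1 \<in> S"
      using p d0 \<epsilon>_diff[of p p] by (auto simp: S_def d_def image_iff intro: bexI[of _ p] bexI[of _ p'])
    fix x y assume "x \<in> S" "y \<in> S" "x \<noteq> y"
    then obtain u v where uv: "u \<in> P" "v \<in> P" "x = \<epsilon> (u - p) / d" "y = \<epsilon> (v - p) / d" "u \<noteq> v"
      by (auto simp: S_def)
    have "x - y = \<epsilon> (u - v) / d"
      by (simp add: uv \<epsilon>_diff diff_divide_distrib)
    then show "(x - y) ^ ((q\<^sup>2 - 1) div 2) = 1"
      using sq[OF uv(1,2,5)] sq[OF p(2,1,3)] by (simp add: power_divide d_def)
  qed
  have "P \<subseteq> range (\<lambda>t. p + gauss_of t * (p' - p))"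
  proof
    fix u assume "u \<in> P"
    then have "\<epsilon> (u - p) / d \<in> range to_ac"
      using \<open>S \<subseteq> _\<close> unfolding range_ac S_def by blast
    then obtain t where "\<epsilon> (u - p) = to_ac t * d" using d0 by (auto simp: field_simps)
    then have "\<epsilon> (u - p) = \<epsilon> (gauss_of t * (p' - p))" by (simp only: \<epsilon>_mult \<epsilon>_of d_def)
    then have "u - p = gauss_of t * (p' - p)" by (rule injD[OF inj])
    then have "u = p + gauss_of t * (p' - p)" by (simp add: algebra_simps)
    then show "u \<in> range (\<lambda>t. p + gauss_of t * (p' - p))" by blast
  qed
  moreover have "card (range (\<lambda>t. p + gauss_of t * (p' - p))) \<le> card P"
    using card_image_le[of UNIV "\<lambda>t. p + gauss_of t * (p' - p)"] q(1) P(2) by simp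
  ultimately have "P = range (\<lambda>t. p + gauss_of t * (p' - p))"
    by (intro card_seteq) auto
  then show ?thesis
    using nz[OF p(2,1,3)] by (intro integral_line_isomorphic) auto
qed

text \<open>When \<open>\<omega>\<^sup>2 = -1\<close>, the coordinates \<open>x = a + \<omega> b\<close> and \<open>y = a - \<omega> b\<close> identify the ring with
  \<open>F \<times> F\<close>, and the norm becomes \<open>x y\<close>.\<close>

theorem integral_point_set_1_mod_4:
  fixes P :: "'a::{field,finite} gauss set" and \<omega> :: 'a
  assumes pr: "prime (card (UNIV :: 'a set))" and large: "card (UNIV :: 'a set) \<ge> 13"
    and \<omega>2: "\<omega> ^ 2 = -1"
    and P: "integral_point_set P" "card P = card (UNIV :: 'a set)"
  shows "isomorphic_point_sets P {gauss_of t | t. True} \<or>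
    isomorphic_point_sets P {(1 + gauss_of \<omega> * gauss_i) * gauss_of t | t. True} \<or>
    isomorphic_point_sets P
        ({(1 + gauss_of \<omega> * gauss_i) * gauss_of s | s. s \<in> squares} \<union>
         {(1 - gauss_of \<omega> * gauss_i) * gauss_of s | s. s \<in> squares})"
proof -
  have \<omega>: "\<omega> * \<omega> = -1" "\<omega> \<noteq> 0" using \<omega>2 by (auto simp: power2_eq_square)
  have \<omega>': "\<omega> * (\<omega> * z) = - z" for z by (simp add: \<omega> mult.assoc[symmetric])
  have two: "(2::'a) \<noteq> 0"
    using of_nat_neq_0_below_prime_card[where ?'a = 'a, of 2] pr large by auto
  have "(2::'a) * 2 \<noteq> 0" using two by (simp only: mult_eq_0_iff) simp
  then have four: "(4::'a) \<noteq> 0" by simp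
  define U where "U z = gauss_re z + \<omega> * gauss_im z" for z
  define V where "V z = gauss_re z - \<omega> * gauss_im z" for z
  define E where "E x y = gauss_of ((x + y) / 2) + gauss_of ((x - y) / (2 * \<omega>)) * gauss_i" for x y
  have UV_diff: "U (u - v) = U u - U v" "V (u - v) = V u - V v" for u v
    by (simp_all add: U_def V_def algebra_simps)
  have UV_add: "U (u + v) = U u + U v" "V (u + v) = V u + V v" for u v
    by (simp_all add: U_def V_def algebra_simps)
  have UV_mult: "U (u * v) = U u * U v" "V (u * v) = V u * V v" for u v
    by (simp_all add: U_def V_def algebra_simps \<omega>')
  have UV_of: "U (gauss_of t) = t" "V (gauss_of t) = t" for t
    by (simp_all add: U_def V_def)
  have UV_conj: "U (gconj z) = V z" "V (gconj z) = U z" for z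
    by (simp_all add: U_def V_def)
  have norm: "gnorm z = U z * V z" for z
    by (simp add: gnorm_def U_def V_def power2_eq_square algebra_simps \<omega>')
  have UV_E: "U (E x y) = x" "V (E x y) = y" for x y
    using \<omega> two four by (simp_all add: U_def V_def E_def field_simps)
  have eqI: "u = v" if "U u = U v" "V u = V v" for u v
  proof (rule gauss_eqI)
    have "U z + V z = 2 * gauss_re z" for z by (simp add: U_def V_def)
    then have "2 * gauss_re u = 2 * gauss_re v" using that by metis
    then show re: "gauss_re u = gauss_re v" using two by simp
    show "gauss_im u = gauss_im v" using that(1) \<omega>(2) unfolding U_def re by simp
  qed
  \<comment> \<open>Since \<open>1 + \<omega> * \<omega> = 0\<close>, the two special directions are
    the axes of the coordinates \<open>(U, V)\<close>.\<close>
  have w1: "(1 + gauss_of \<omega> * gauss_i) * gauss_of t = E 0 (2 * t)"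
    and w2: "(1 - gauss_of \<omega> * gauss_i) * gauss_of t = E (2 * t) 0" for t
  proof -
    have "U (1 + gauss_of \<omega> * gauss_i) = 0" "V (1 + gauss_of \<omega> * gauss_i) = 2"
      "U (1 - gauss_of \<omega> * gauss_i) = 2" "V (1 - gauss_of \<omega> * gauss_i) = 0"
      by (simp_all add: U_def V_def \<omega>)
    then show "(1 + gauss_of \<omega> * gauss_i) * gauss_of t = E 0 (2 * t)"
      "(1 - gauss_of \<omega> * gauss_i) * gauss_of t = E (2 * t) 0"
      by (intro eqI; simp add: UV_mult UV_of UV_E)+
  qed
  have E_XY: "E (U z) (V z) = z" for z by (rule eqI) (simp_all add: UV_E)
  define S where "S = (\<lambda>z. (U z, V z)) ` P"
  have P_S: "P = (\<lambda>(x, y). E x y) ` S"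
    by (simp add: S_def image_image E_XY)
  have cS: "card S = card (UNIV :: 'a set)"
    unfolding S_def P(2)[symmetric] by (rule card_image) (auto intro: inj_onI eqI)
  have clique: "(x - x') * (y - y') \<in> squares" if S: "(x, y) \<in> S" "(x', y') \<in> S" for x y x' y'
  proof -
    obtain u v where uv: "u \<in> P" "v \<in> P" "x = U u" "y = V u" "x' = U v" "y' = V v"
      using S by (auto simp: S_def)
    have "gnorm (u - v) \<in> squares"
      using P(1) uv(1,2) unfolding integral_point_set_def int_dist_def sqdist_eq_gnorm
      by (metis zero_neq_one)
    then show ?thesis by (simp add: norm UV_diff uv)
  qed
  have one_sq: "1 \<in> squares" unfolding squares_def by (metis (mono_tags, lifting) mem_Collect_eq one_power2)
  \<comment> \<open>Rescaling the parameter does not change a line; the factor 2 matches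
    \<open>w1\<close>.\<close>
  have halve: "range (\<lambda>t. f (c * t)) = range (\<lambda>t. f (2 * t))" if "c \<noteq> 0" for f :: "'a \<Rightarrow> 'a gauss" and c
  proof -
    have s: "range ((*) d) = UNIV" if "d \<noteq> 0" for d :: 'a
      using that by (intro surjI[of _ "\<lambda>x. x / d"]) simp
    have "range (\<lambda>t. f (d * t)) = f ` range ((*) d)" for d by (simp add: image_image)
    then show ?thesis using s[OF that] s[OF two] by simp
  qed
  consider x0 y0 x1 y1 where "(x1, y1) \<noteq> (0, 0)" "S = range (\<lambda>t. (x0 + x1 * t, y0 + y1 * t))"
    | x0 y0 x1 y1 where "x1 \<noteq> 0" "y1 \<noteq> 0"
      "S = (\<lambda>s. (x0 + x1 * s, y0)) ` squares \<union> (\<lambda>s. (x0, y0 + y1 * s)) ` squares"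
    using prime_field_clique[OF pr large cS] clique by blast
  then show ?thesis
  proof cases
    case 1
    define p where "p = E x0 y0"
    have PE: "P = range (\<lambda>t. E (x0 + x1 * t) (y0 + y1 * t))"
      unfolding P_S 1(2) image_image by simp
    have E_p: "E (x0 + x) (y0 + y) - p = E x y" for x y
      by (rule eqI) (simp_all add: p_def UV_diff UV_E)
    show ?thesis
    proof (cases "x1 = 0 \<or> y1 = 0")
      case False
      have "E (x0 + x1 * t) (y0 + y1 * t) = p + gauss_of t * E x1 y1" for t
        by (rule eqI) (simp_all add: p_def UV_add UV_mult UV_of UV_E)
      then have "P = range (\<lambda>t. p + gauss_of t * E x1 y1)" unfolding PE by simp
      moreover have "gnorm (E x1 y1) = x1 * y1" by (simp add: norm UV_E)
      moreover have "(x0 + x1 * t, y0 + y1 * t) \<in> S" for t unfolding 1(2) by blast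
      from clique[OF this this, of 1 0] have "x1 * y1 \<in> squares" by simp
      ultimately have "isomorphic_point_sets P {gauss_of t | t. True}"
        using False by (intro integral_line_isomorphic) auto
      then show ?thesis ..
    next
      case True
      \<comment> \<open>An isotropic direction has norm 0 and cannot be divided out. A translation
        suffices for one axis, and conjugation carries the other axis onto it.\<close>
      have "\<exists>\<phi>. int_automorphism \<phi> \<and> \<phi> ` P = range (\<lambda>t. E 0 (2 * t))"
      proof (cases "x1 = 0")
        case True
        then have "y1 \<noteq> 0" using 1(1) by simp
        have "int_automorphism (\<lambda>z. 1 * (z - p))"
          by (intro int_automorphism_mult) (simp_all add: gnorm_def one_sq)
        moreover have "(\<lambda>z. 1 * (z - p)) ` P = range (\<lambda>t. E 0 (y1 * t))"
          unfolding PE image_image using E_p[of 0] by (simp add: True)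
        ultimately show ?thesis unfolding halve[OF \<open>y1 \<noteq> 0\<close>] by (intro exI conjI)
      next
        case False
        with True have "y1 = 0" by simp
        have conj: "gconj (E x y) = E y x" for x y by (rule eqI) (simp_all add: UV_conj UV_E)
        have "(\<lambda>z. gconj (z - p)) ` P = range (\<lambda>t. E 0 (x1 * t))"
          unfolding PE image_image using E_p[of _ 0] by (simp add: \<open>y1 = 0\<close> conj)
        with int_automorphism_conj show ?thesis unfolding halve[OF False] by (intro exI conjI)
      qed
      then have "isomorphic_point_sets P (range (\<lambda>t. E 0 (2 * t)))"
        unfolding isomorphic_point_sets_def .
      then show ?thesis unfolding w1 by (simp add: full_SetCompr_eq)
    qed
  next
    case 2
    define p where "p = E x0 y0"
    \<comment> \<open>Multiplication by \<open>w\<close> rescales both half lines to the factor 2 of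
      \<open>w1\<close> and \<open>w2\<close>.\<close>
    define w where "w = E (2 / x1) (2 / y1)"
    \<comment> \<open>One point from each half line shows that \<open>- (x1 * y1)\<close> is a
      square. As -1 is the square of \<open>\<omega>\<close>, the norm of \<open>w\<close> is a
      square too.\<close>
    have "(x0 + x1 * 1, y0) \<in> S" "(x0, y0 + y1 * 1) \<in> S" using one_sq unfolding 2(3) by blast+
    from clique[OF this] obtain r where r: "- (x1 * y1) = r ^ 2" by (auto simp: squares_def)
    have nw: "gnorm w = 4 / (x1 * y1)" by (simp add: w_def norm UV_E)
    have "4 / (x1 * y1) = (2 * \<omega> * r / (x1 * y1)) ^ 2"
    proof -
      have "(2 * \<omega> * r / (x1 * y1)) ^ 2 = 4 * (\<omega> ^ 2) * (r ^ 2) / (x1 * y1) ^ 2"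
        by (simp add: power_mult_distrib power_divide)
      also have "\<dots> = 4 * (x1 * y1) / (x1 * y1) ^ 2" by (simp add: \<omega>2 r[symmetric])
      also have "\<dots> = 4 / (x1 * y1)" using 2(1,2) by (simp add: power2_eq_square)
      finally show ?thesis ..
    qed
    then have "gnorm w \<in> squares" unfolding nw squares_def by blast
    moreover have "gnorm w \<noteq> 0" using 2(1,2) four by (simp add: nw)
    ultimately have "int_automorphism (\<lambda>z. w * (z - p))" by (rule int_automorphism_mult)
    moreover have "w * (E (x0 + x1 * s) y0 - p) = E (2 * s) 0" "w * (E x0 (y0 + y1 * s) - p) = E 0 (2 * s)" for s
      using 2(1,2) by (intro eqI; simp add: w_def p_def UV_mult UV_diff UV_E)+
    then have "(\<lambda>z. w * (z - p)) ` P = (\<lambda>s. E (2 * s) 0) ` squares \<union> (\<lambda>s. E 0 (2 * s)) ` squares"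
      unfolding P_S 2(3) image_Un image_image by simp
    ultimately have "isomorphic_point_sets P ((\<lambda>s. E 0 (2 * s)) ` squares \<union> (\<lambda>s. E (2 * s) 0) ` squares)"
      unfolding isomorphic_point_sets_def Un_commute[of "(\<lambda>s. E 0 (2 * s)) ` squares"]
      by (intro exI conjI)
    then show ?thesis unfolding w1 w2 by (simp add: image_def Setcompr_eq_image)
  qed
qed

theorem theorem6:
  fixes p r q :: nat
    and \<omega> :: "'a::{field, finite}"
    and P :: "'a gauss set"
  assumes "prime p" and "p \<noteq> 2"
    and "q = p ^ r" and "q > 9"
    and "card (UNIV :: 'a set) = q"
    and "r = 1 \<or> q mod 4 = 3"
    and "q mod 4 = 1 \<longrightarrow> \<omega> ^ 2 = -1"
    and "integral_point_set P"
    and "card P = q"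
  shows "isomorphic_point_sets P {gauss_of t | t. True} \<or>
    (q mod 4 = 1 \<and>
      isomorphic_point_sets P {(1 + gauss_of \<omega> * gauss_i) * gauss_of t | t. True}) \<or>
    (q mod 4 = 1 \<and>
      isomorphic_point_sets P
        ({(1 + gauss_of \<omega> * gauss_i) * gauss_of s | s. s \<in> squares} \<union>
         {(1 - gauss_of \<omega> * gauss_i) * gauss_of s | s. s \<in> squares}))"
proof (cases "q mod 4 = 3")
  case True
  have "of_nat (p ^ r) = (0 :: 'a)" using of_nat_card_UNIV[where ?'a = 'a] assms(3,5) by simp
  then have "CHAR('a) dvd p ^ r" by (simp only: of_nat_eq_0_iff_char_dvd)
  moreover have "prime CHAR('a)"
    by (intro prime_CHAR_semidom finite_imp_CHAR_pos finite)
  ultimately have "CHAR('a) = p"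
    using assms(1) prime_dvd_power primes_dvd_imp_eq by blast
  then have "isomorphic_point_sets P {gauss_of t | t. True}"
    using assms True by (intro integral_point_set_3_mod_4[where q = q and r = r]) auto
  then show ?thesis ..
next
  case False
  \<comment> \<open>Now \<open>q\<close> is an odd prime congruent to 1 modulo 4, and above 9 this
    class starts at 13.\<close>
  then have r: "r = 1" using assms(6) by simp
  then have "q = p" using assms(3) by simp
  then have "odd q" using assms(1,2) prime_odd_nat[of p] prime_ge_2_nat[of p] by force
  then have mod: "q mod 4 = 1" using False by presburger
  then have "q \<ge> 13" using assms(4) by presburger
  then show ?thesis
    using integral_point_set_1_mod_4[of \<omega> P] assms mod \<open>q = p\<close> by simp
qed

end
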